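(* Let $X$ be a metric space, $K\subset X$ a compact subset, and let $\pi:X\times\mathcal{B}(X)\to[0,1]$ be a transition function for a discrete-time Markov chain $\Phi$. Assume that there exists $z\in X$ such that for every $\varepsilon>0$ there exists $\alpha>0$ such that $\liminf_{n\to\infty}\pi^n(x,B(z,\varepsilon))\ge\alpha$ for every $x\in X$, and that for every $\varphi\in C_b(X)$ the family of functions $\left\{x\mapsto\int_X\varphi(y)\,\pi^n(x,dy):n\in\mathbb{N}\right\}$ is equicontinuous (at every point of $X$). Let $\mu_{\ast}$ be the unique invariant probability measure of $\Phi$ (which exists under these assumptions). Then for every $\varphi\in C_b(X)$ $$\lim_{n\to\infty}\ \sup_{\mu\in\mathcal{M}_1(X),\ \operatorname{supp}\mu\subset K}\left|\left\langle\varphi,\int_X\pi^n(x,\cdot)\,\mu(dx)\right\rangle-\langle\varphi,\mu_{\ast}\rangle\right|=0.$$ In particular, $\pi^n(x,\cdot)$ converges weakly to $\mu_{\ast}$ uniformly on compact subsets of $X$, i.e. for every compact $K\subset X$ and every $\varphi\in C_b(X)$, $\lim_{n\to\infty}\sup_{x\in K}\left|\int_X\varphi(y)\,\pi^n(x,dy)-\langle\varphi,\mu_{\ast}\rangle\right|=0$.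
   Context: $X$ is an arbitrary metric space (not assumed separable or complete). $B(x,r)$ is the open ball with centre $x$ and radius $r$; $\mathcal{B}(X)$ is the Borel $\sigma$-algebra; $C_b(X)$ is the space of real bounded continuous functions on $X$; $\mathcal{M}_1(X)$ is the set of (countably additive) Borel probability measures on $X$; $\langle\varphi,\mu\rangle=\int_X\varphi\,d\mu$. The condition $\operatorname{supp}\mu\subset K$ means that $\mu$ is concentrated on $K$, i.e. $\mu(X\setminus K)=0$. A transition function $\pi$ is a Markov (probability) kernel: $\pi(x,\cdot)\in\mathcal{M}_1(X)$ for each $x$, and $\pi(\cdot,A)$ is Borel measurable for each $A\in\mathcal{B}(X)$. Its iterates are $\pi^1=\pi$, $\pi^{n+1}(x,A)=\int_X\pi^n(y,A)\,\pi(x,dy)$. A measure $\mu_{\ast}\in\mathcal{M}_1(X)$ is invariant for $\Phi$ if $\int_X\pi(x,A)\,\mu_{\ast}(dx)=\mu_{\ast}(A)$ for all $A\in\mathcal{B}(X)$. A family $\{f_n\}$ of functions is equicontinuous at $x$ if $\lim_{y\to x}\sup_n|f_n(y)-f_n(x)|=0$. *)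

theory Defs
  imports "HOL-Probability.Probability"
begin

text \<open>
  The metric space is a type of class \<^class>\<open>metric_space\<close>, and the Borel probability
  measures on it are the elements of \<^term>\<open>space (prob_algebra borel)\<close>.
\<close>

lemma in_space_prob_algebra_borel:
  "\<mu> \<in> space (prob_algebra borel) \<longleftrightarrow> sets \<mu> = sets borel \<and> prob_space \<mu>"
  by (auto simp: space_prob_algebra)

abbreviation transition_function :: "('a::metric_space \<Rightarrow> 'a measure) \<Rightarrow> bool" where
  "transition_function \<pi> \<equiv> \<pi> \<in> borel \<rightarrow>\<^sub>M prob_algebra borel"

lemma transition_function_iff:
  "transition_function \<pi> \<longleftrightarrow>
     (\<forall>x. \<pi> x \<in> space (prob_algebra borel)) \<and>
     (\<forall>A\<in>sets borel. (\<lambda>x. measure (\<pi> x) A) \<in> borel_measurable borel)"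
proof
  assume \<pi>: "transition_function \<pi>"
  then have "\<pi> \<in> borel \<rightarrow>\<^sub>M subprob_algebra borel"
    by (rule measurable_prob_algebraD)
  then have "(\<lambda>x. measure (\<pi> x) A) \<in> borel_measurable borel" if "A \<in> sets borel" for A
    using measurable_compose[OF _ measurable_measure_subprob_algebra] that by blast
  then show "(\<forall>x. \<pi> x \<in> space (prob_algebra borel)) \<and>
     (\<forall>A\<in>sets borel. (\<lambda>x. measure (\<pi> x) A) \<in> borel_measurable borel)"
    using measurable_space[OF \<pi>] by simp
next
  assume *: "(\<forall>x. \<pi> x \<in> space (prob_algebra borel)) \<and>
     (\<forall>A\<in>sets borel. (\<lambda>x. measure (\<pi> x) A) \<in> borel_measurable borel)"
  then have p: "prob_space (\<pi> x)" "sets (\<pi> x) = sets borel" for x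
    by (auto simp: space_prob_algebra)
  show "transition_function \<pi>"
  proof (rule measurable_prob_algebraI)
    show "prob_space (\<pi> x)" for x by (rule p)
    show "\<pi> \<in> borel \<rightarrow>\<^sub>M subprob_algebra borel"
    proof (rule measurable_subprob_algebra)
      show "subprob_space (\<pi> x)" for x
        using p(1) by (rule prob_space_imp_subprob_space)
      show "sets (\<pi> x) = sets borel" for x by (rule p)
      fix A :: "'a set" assume A: "A \<in> sets borel"
      have "emeasure (\<pi> x) A = ennreal (measure (\<pi> x) A)" for x
      proof -
        interpret prob_space "\<pi> x" by (rule p)
        show ?thesis by (rule emeasure_eq_measure)
      qed
      with * A show "(\<lambda>x. emeasure (\<pi> x) A) \<in> borel_measurable borel" by simp
    qed
  qed
qed

text \<open>
  The iterates, with the convention that the zeroth one is the Dirac kernel. The lemmas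
  \<open>iterate_1\<close> and \<open>measure_iterate_Suc\<close> are the recursion
  $\pi^1 = \pi$, $\pi^{n+1}(x,A) = \int \pi^n(y,A)\,\pi(x,dy)$.
\<close>

primrec iterate :: "('a::metric_space \<Rightarrow> 'a measure) \<Rightarrow> nat \<Rightarrow> 'a \<Rightarrow> 'a measure" where
  "iterate \<pi> 0 = return borel"
| "iterate \<pi> (Suc n) = (\<lambda>x. \<pi> x \<bind> iterate \<pi> n)"

lemma iterate_1:
  assumes "transition_function \<pi>"
  shows "iterate \<pi> 1 x = \<pi> x"
  using measurable_space[OF assms, of x] by (simp add: space_prob_algebra bind_return'')

lemma transition_function_iterate:
  assumes [measurable]: "transition_function \<pi>"
  shows "transition_function (iterate \<pi> n)"
proof (induction n)
  case 0
  show ?case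
    by (auto intro!: measurable_prob_algebraI prob_space_return)
next
  case (Suc n)
  note [measurable] = this
  show ?case by (simp, measurable)
qed

lemma measure_bind_iterate:
  assumes \<pi>: "transition_function \<pi>"
    and \<mu>: "\<mu> \<in> space (prob_algebra borel)" and A: "A \<in> sets borel"
  shows "measure (\<mu> \<bind> iterate \<pi> n) A = (\<integral>x. measure (iterate \<pi> n x) A \<partial>\<mu>)"
proof -
  have s: "sets \<mu> = sets borel" and p: "prob_space \<mu>"
    using \<mu> by (auto simp: space_prob_algebra)
  interpret prob_space \<mu> by (rule p)
  have "iterate \<pi> n \<in> \<mu> \<rightarrow>\<^sub>M subprob_algebra borel"
    using measurable_prob_algebraD[OF transition_function_iterate[OF \<pi>, of n]]
    by (simp add: measurable_cong_sets[OF s refl])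
  then show ?thesis using A by (rule measure_bind)
qed

lemma measure_iterate_Suc:
  assumes "transition_function \<pi>" and "A \<in> sets borel"
  shows "measure (iterate \<pi> (Suc n) x) A = (\<integral>y. measure (iterate \<pi> n y) A \<partial>\<pi> x)"
  using measure_bind_iterate[OF assms(1) _ assms(2), of "\<pi> x" n] measurable_space[OF assms(1), of x]
  by simp

definition invariant_prob :: "('a::metric_space \<Rightarrow> 'a measure) \<Rightarrow> 'a measure \<Rightarrow> bool" where
  "invariant_prob \<pi> \<mu> \<longleftrightarrow> \<mu> \<in> space (prob_algebra borel) \<and>
     (\<forall>A\<in>sets borel. (\<integral>x. measure (\<pi> x) A \<partial>\<mu>) = measure \<mu> A)"

text \<open>
  Suprema of nonnegative quantities are taken in \<^typ>\<open>ennreal\<close>: they always exist there, and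
  the supremum of the empty set is \<open>0\<close> (on \<^typ>\<open>real\<close> it is unspecified).
\<close>

definition equicontinuous_at ::
    "'i set \<Rightarrow> ('i \<Rightarrow> 'a::metric_space \<Rightarrow> real) \<Rightarrow> 'a \<Rightarrow> bool" where
  "equicontinuous_at I f x \<longleftrightarrow>
     ((\<lambda>y. SUP i\<in>I. ennreal \<bar>f i y - f i x\<bar>) \<longlongrightarrow> 0) (at x)"

end

theory Submission
  imports Defs
begin

text \<open>
  Write \<open>f\<^sub>n(x)\<close> for the integral of \<open>\<phi>\<close> against \<open>\<pi>\<^sup>n(x, \<cdot>)\<close>. Coupling near \<open>z\<close> shows that
  \<open>f\<^sub>n(x) - f\<^sub>n(y) \<rightarrow> 0\<close> for all \<open>x\<close> and \<open>y\<close>. A gliding hump argument, combining the lower bound with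
  equicontinuity at \<open>z\<close>, shows that the measures \<open>\<pi>\<^sup>n(z, \<cdot>)\<close> are uniformly smooth: if continuous
  functions decrease pointwise to \<open>0\<close>, their means tend to \<open>0\<close> uniformly in \<open>n\<close>. Applied to
  \<open>x \<mapsto> sup {\<bar>f\<^sub>k(x) - f\<^sub>k(z)\<bar> | k \<ge> n}\<close>, this makes \<open>f\<^sub>n(z)\<close> a Cauchy sequence. Its limit is a positive
  linear functional of \<open>\<phi>\<close>, again smooth along decreasing sequences, hence the integral against a Borel
  probability measure even though the space is neither complete nor separable; this is the
  invariant measure. Uniformity on compact sets follows from equicontinuity.
\<close>

subsection \<open>Bounded continuous functions\<close>

text \<open>Without completeness or separability tightness of the laws
  \<open>\<pi>\<^sup>n(z, \<cdot>)\<close> is not at hand, so no weak limit can be extracted by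
  Prokhorov's theorem. Smoothness along decreasing sequences, Daniell's condition, replaces it: this
  is what makes a positive functional countably additive. Merging alone does not give convergence
  either. The difference of \<open>f\<^sub>n(z)\<close> and \<open>f\<^sub>j(z)\<close> averages
  \<open>f\<^sub>j - f\<^sub>j(z)\<close> over a law that changes with n, and mass might drift to
  regions where merging is slow; smoothness uniform in n rules this out. Its proof builds a test
  function adapted to the chain, an infinite sum of blocks that is continuous but has no prescribed
  modulus. Equicontinuity is therefore used for all bounded continuous functions and not just for
  Lipschitz ones.\<close>

lemma bcontfunI_bounds:
  fixes f :: "'a::topological_space \<Rightarrow> real"
  assumes "continuous_on UNIV f" "\<And>x. a \<le> f x" "\<And>x. f x \<le> b"
  shows "f \<in> bcontfun"
proof (rule bcontfun_normI[OF assms(1), where b="max \<bar>a\<bar> \<bar>b\<bar>"])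
  show "norm (f x) \<le> max \<bar>a\<bar> \<bar>b\<bar>" for x using assms(2,3)[of x] by auto
qed

lemma bcontfun_continuous: "f \<in> bcontfun \<Longrightarrow> continuous_on UNIV f"
  by (simp add: bcontfun_def)

lemma bcontfun_bounded:
  fixes f :: "'a::topological_space \<Rightarrow> real"
  assumes "f \<in> bcontfun"
  obtains C where "C > 0" "\<And>x. \<bar>f x\<bar> \<le> C"
proof -
  obtain C where "C > 0" "\<forall>y\<in>range f. norm y \<le> C"
    using assms by (auto simp: bcontfun_def bounded_pos)
  then show ?thesis using that by auto
qed

lemma bcontfun_measurable:
  fixes f :: "'a::topological_space \<Rightarrow> real"
  shows "f \<in> bcontfun \<Longrightarrow> f \<in> borel_measurable borel"
  by (simp add: bcontfun_continuous borel_measurable_continuous_onI)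

lemma mult_cont:
  fixes f :: "'a::topological_space \<Rightarrow> real"
  shows "f \<in> bcontfun \<Longrightarrow> (\<lambda>x. c * f x) \<in> bcontfun"
  using scaleR_cont[of f c] by simp

lemma sum_cont:
  fixes f :: "'i \<Rightarrow> 'a::topological_space \<Rightarrow> real"
  shows "(\<And>i. i \<in> I \<Longrightarrow> f i \<in> bcontfun) \<Longrightarrow> (\<lambda>x. \<Sum>i\<in>I. f i x) \<in> bcontfun"
  by (induction I rule: infinite_finite_induct) (auto intro: const_bcontfun plus_cont)

lemma min_cont:
  fixes f g :: "'a::topological_space \<Rightarrow> real"
  assumes "f \<in> bcontfun" "g \<in> bcontfun"
  shows "(\<lambda>x. min (f x) (g x)) \<in> bcontfun"
proof -
  obtain C D where "\<And>x. \<bar>f x\<bar> \<le> C" "\<And>x. \<bar>g x\<bar> \<le> D"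
    using assms by (meson bcontfun_bounded)
  then have "norm (min (f x) (g x)) \<le> max C D" for x
    by (cases "f x \<le> g x") (auto simp: min_def le_max_iff_disj)
  with assms show ?thesis
    by (intro bcontfun_normI[where b="max C D"] continuous_on_min) (auto intro: bcontfun_continuous)
qed

lemma max_cont:
  fixes f g :: "'a::topological_space \<Rightarrow> real"
  assumes "f \<in> bcontfun" "g \<in> bcontfun"
  shows "(\<lambda>x. max (f x) (g x)) \<in> bcontfun"
  using uminus_cont[OF min_cont[OF uminus_cont[OF assms(1)] uminus_cont[OF assms(2)]]]
  by (simp add: minus_min_eq_max)

text \<open>The case distinction is needed because the distance to the empty set is \<open>0\<close>.\<close>

definition bump :: "'a::metric_space set \<Rightarrow> nat \<Rightarrow> 'a \<Rightarrow> real" where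
  "bump U k x = (if U = UNIV then 1 else min 1 (real k * infdist x (- U)))"

lemma bump_bcontfun: "bump U k \<in> bcontfun"
proof (rule bcontfunI_bounds[where a=0 and b=1])
  show "continuous_on UNIV (bump U k)"
    unfolding bump_def by (cases "U = UNIV") (auto intro!: continuous_intros)
qed (auto simp: bump_def infdist_nonneg)

lemma bump_nonneg: "0 \<le> bump U k x"
  by (auto simp: bump_def infdist_nonneg)

lemma bump_le_indicator: "bump U k x \<le> indicator U x"
  by (auto simp: bump_def indicator_def)

lemma bump_le_1: "bump U k x \<le> 1"
  by (simp add: bump_def)

lemma bump_mono: "k \<le> l \<Longrightarrow> bump U k x \<le> bump U l x"
  using mult_right_mono[of "real k" "real l" "infdist x (- U)"]
  by (auto simp: bump_def infdist_nonneg min_le_iff_disj)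

text \<open>A point of an open set has positive distance to the complement, so a steep enough bump
  reaches 1. Equality from some k on, rather than mere convergence, lets a cut-off by bumps become
  exact at each point.\<close>

lemma eventually_bump_eq_1:
  assumes "open U" "x \<in> U"
  shows "eventually (\<lambda>k. bump U k x = 1) sequentially"
proof (cases "U = UNIV")
  case False
  then have "infdist x (- U) > 0"
    using assms infdist_nonneg[of x "- U"] in_closed_iff_infdist_zero[of "- U" x] by force
  moreover obtain n where "1 / infdist x (- U) < real n" using reals_Archimedean2 by blast
  ultimately have "bump U n x = 1"
    using False by (auto simp: bump_def field_simps)
  then have "bump U k x = 1" if "n \<le> k" for k
    using bump_mono[OF that, of U x] bump_le_indicator[of U k x] \<open>x \<in> U\<close> by simp
  then show ?thesis by (auto simp: eventually_sequentially)
qed (simp add: bump_def)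

lemma bump_tendsto_indicator:
  assumes "open U"
  shows "(\<lambda>k. bump U k x) \<longlonglongrightarrow> indicator U x"
proof (cases "x \<in> U")
  case True
  then show ?thesis
    using eventually_bump_eq_1[OF assms, of x] by (auto intro: tendsto_eventually)
next
  case False
  then have "bump U k x = 0" for k
    using bump_nonneg[of U k x] bump_le_indicator[of U k x] by simp
  then show ?thesis using False by simp
qed

section \<open>Borel probability measures and their integrals of bounded continuous
  functions\<close>

lemma integrable_bcontfun:
  fixes \<phi> :: "'a::topological_space \<Rightarrow> real"
  assumes \<mu>: "\<mu> \<in> space (prob_algebra borel)" and \<phi>: "\<phi> \<in> bcontfun"
  shows "integrable \<mu> \<phi>"
proof -
  have s: "sets \<mu> = sets borel" and "prob_space \<mu>"
    using \<mu> by (auto simp: space_prob_algebra)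
  interpret prob_space \<mu> by fact
  obtain C where "\<And>x. \<bar>\<phi> x\<bar> \<le> C" using bcontfun_bounded[OF \<phi>] by metis
  then show ?thesis
    using bcontfun_measurable[OF \<phi>]
    by (intro integrable_const_bound[where B=C]) (auto simp: measurable_cong_sets[OF s refl])
qed

text \<open>Open sets form an intersection-stable generator, and their indicators are pointwise
  limits of bumps, so dominated convergence suffices. This serves both the invariance of the limit
  measure and uniqueness.\<close>

lemma borel_prob_eqI_bcontfun:
  fixes \<mu> \<nu> :: "'a::metric_space measure"
  assumes \<mu>: "\<mu> \<in> space (prob_algebra borel)" and \<nu>: "\<nu> \<in> space (prob_algebra borel)"
    and eq: "\<And>\<phi> :: 'a \<Rightarrow> real. \<phi> \<in> bcontfun \<Longrightarrow> (\<integral>x. \<phi> x \<partial>\<mu>) = (\<integral>x. \<phi> x \<partial>\<nu>)"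
  shows "\<mu> = \<nu>"
proof (rule measure_eqI_generator_eq[where E="{U. open U}" and \<Omega>=UNIV and A="\<lambda>_. UNIV"])
  have s[measurable_cong]: "sets \<mu> = sets borel" "sets \<nu> = sets borel"
    and "prob_space \<mu>" "prob_space \<nu>"
    using \<mu> \<nu> by (auto simp: space_prob_algebra)
  interpret \<mu>: prob_space \<mu> by fact
  interpret \<nu>: prob_space \<nu> by fact
  show "Int_stable {U::'a set. open U}" by (auto simp: Int_stable_def)
  show "sets \<mu> = sigma_sets UNIV {U. open U}" "sets \<nu> = sigma_sets UNIV {U. open U}"
    by (simp_all add: s sets_borel)
  show "emeasure \<mu> UNIV \<noteq> \<infinity>" by simp
  fix U :: "'a set" assume "U \<in> {U. open U}"
  then have U: "open U" by simp
  then have [measurable]: "U \<in> sets borel" by simp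
  have m: "bump U k \<in> borel_measurable borel" for k
    by (rule bcontfun_measurable[OF bump_bcontfun])
  have b: "\<bar>bump U k x\<bar> \<le> 1" for k x
    using bump_nonneg[of U k x] bump_le_1[of U k x] by simp
  have "(\<lambda>k. \<integral>x. bump U k x \<partial>\<mu>) \<longlonglongrightarrow> (\<integral>x. indicator U x \<partial>\<mu>)"
    by (rule integral_dominated_convergence[where w="\<lambda>_. 1"])
       (use m b bump_tendsto_indicator[OF U] in \<open>auto\<close>)
  moreover have "(\<lambda>k. \<integral>x. bump U k x \<partial>\<nu>) \<longlonglongrightarrow> (\<integral>x. indicator U x \<partial>\<nu>)"
    by (rule integral_dominated_convergence[where w="\<lambda>_. 1"])
       (use m b bump_tendsto_indicator[OF U] in \<open>auto\<close>)
  ultimately have "(\<integral>x. indicator U x \<partial>\<mu>) = (\<integral>x. indicator U x \<partial>\<nu> :: real)"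
    unfolding eq[OF bump_bcontfun] by (rule LIMSEQ_unique)
  then show "emeasure \<mu> U = emeasure \<nu> U"
    by (simp add: \<mu>.emeasure_eq_measure \<nu>.emeasure_eq_measure
        sets_eq_imp_space_eq[OF s(1)] sets_eq_imp_space_eq[OF s(2)])
qed auto

subsection \<open>Representation of smooth functionals by measures\<close>

text \<open>\<open>smooth\<close> is Daniell's condition. Without it a positive normalised
  functional may come from a merely finitely additive set function.\<close>

locale sigma_smooth_functional =
  fixes L :: "('a::metric_space \<Rightarrow> real) \<Rightarrow> real"
  assumes add: "f \<in> bcontfun \<Longrightarrow> g \<in> bcontfun \<Longrightarrow> L (\<lambda>x. f x + g x) = L f + L g"
    and scale: "f \<in> bcontfun \<Longrightarrow> L (\<lambda>x. c * f x) = c * L f"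
    and nonneg: "f \<in> bcontfun \<Longrightarrow> (\<And>x. 0 \<le> f x) \<Longrightarrow> 0 \<le> L f"
    and one: "L (\<lambda>x. 1) = 1"
    and smooth: "(\<And>j. F j \<in> bcontfun) \<Longrightarrow> (\<And>j x. 0 \<le> F j x) \<Longrightarrow> (\<And>j x. F j x \<le> 1) \<Longrightarrow>
      (\<And>j x. F (Suc j) x \<le> F j x) \<Longrightarrow> (\<And>x. (\<lambda>j. F j x) \<longlonglongrightarrow> 0) \<Longrightarrow> (\<lambda>j. L (F j)) \<longlonglongrightarrow> 0"
begin

lemma diff: "f \<in> bcontfun \<Longrightarrow> g \<in> bcontfun \<Longrightarrow> L (\<lambda>x. f x - g x) = L f - L g"
  using add[of f "\<lambda>x. -1 * g x"] scale[of g "-1"] mult_cont[of g "-1"] by simp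

lemma mono: "f \<in> bcontfun \<Longrightarrow> g \<in> bcontfun \<Longrightarrow> (\<And>x. f x \<le> g x) \<Longrightarrow> L f \<le> L g"
  using nonneg[of "\<lambda>x. g x - f x"] diff[of g f] minus_cont[of g f] by simp

lemma zero: "L (\<lambda>x. 0) = 0"
  using scale[OF const_bcontfun, of 0 1] by simp

lemma const: "L (\<lambda>x. c) = c"
  using scale[OF const_bcontfun, of c 1] one by simp

lemma sum: "(\<And>i. i \<in> I \<Longrightarrow> f i \<in> bcontfun) \<Longrightarrow> L (\<lambda>x. \<Sum>i\<in>I. f i x) = (\<Sum>i\<in>I. L (f i))"
  by (induction I rule: infinite_finite_induct) (simp_all add: zero add sum_cont)

section \<open>Contents of open sets and the outer measure they induce\<close>

definition minorants :: "'a set \<Rightarrow> ('a \<Rightarrow> real) set" where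
  "minorants U = {\<phi> \<in> bcontfun. \<forall>x. 0 \<le> \<phi> x \<and> \<phi> x \<le> indicator U x}"

text \<open>The mass that a representing measure is forced to give to an open set, whose indicator
  is the supremum of its minorants.\<close>

definition content :: "'a set \<Rightarrow> ennreal" where
  "content U = (SUP \<phi>\<in>minorants U. ennreal (L \<phi>))"

definition outer :: "'a set \<Rightarrow> ennreal" where
  "outer A = (INF U\<in>{U. open U \<and> A \<subseteq> U}. content U)"

lemma minorantsD:
  assumes "\<phi> \<in> minorants U"
  shows "\<phi> \<in> bcontfun" "0 \<le> \<phi> x" "\<phi> x \<le> 1" "x \<notin> U \<Longrightarrow> \<phi> x = 0" "0 \<le> L \<phi>"
proof -
  show "\<phi> \<in> bcontfun" "0 \<le> \<phi> x" "\<phi> x \<le> 1"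
    using assms order_trans[OF _ indicator_le_1, of "\<phi> x" U x] by (auto simp: minorants_def)
  show "\<phi> x = 0" if "x \<notin> U"
    using assms that by (auto simp: minorants_def dest!: spec[of _ x])
  show "0 \<le> L \<phi>" using assms by (auto simp: minorants_def intro: nonneg)
qed

lemma minorantsI:
  assumes "\<phi> \<in> bcontfun" "\<And>x. 0 \<le> \<phi> x" "\<And>x. x \<in> U \<Longrightarrow> \<phi> x \<le> 1" "\<And>x. x \<notin> U \<Longrightarrow> \<phi> x = 0"
  shows "\<phi> \<in> minorants U"
  using assms by (auto simp: minorants_def indicator_def)

lemma bump_minorants: "bump U k \<in> minorants U"
  by (auto simp: minorants_def bump_bcontfun bump_nonneg bump_le_indicator)

lemma minorants_nonempty: "minorants U \<noteq> {}"
  using bump_minorants by blast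

lemma content_upper: "\<phi> \<in> minorants U \<Longrightarrow> ennreal (L \<phi>) \<le> content U"
  unfolding content_def by (rule SUP_upper)

lemma content_mono: "U \<subseteq> V \<Longrightarrow> content U \<le> content V"
  unfolding content_def
proof (rule SUP_subset_mono)
  assume "U \<subseteq> V"
  then have "indicator U x \<le> (indicator V x :: real)" for x by (auto simp: indicator_def)
  then show "minorants U \<subseteq> minorants V" by (auto simp: minorants_def intro: order_trans)
qed simp

lemma content_le_1: "content U \<le> 1"
  unfolding content_def
proof (rule SUP_least)
  fix \<phi> assume "\<phi> \<in> minorants U"
  then have "L \<phi> \<le> L (\<lambda>x. 1)"
    by (intro mono) (auto intro: minorantsD const_bcontfun)
  then show "ennreal (L \<phi>) \<le> 1" by (simp add: one)
qed

lemma content_UNIV: "content UNIV = 1"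
proof (rule antisym[OF content_le_1])
  have "(\<lambda>x. 1) \<in> minorants UNIV" by (auto simp: minorants_def const_bcontfun)
  from content_upper[OF this] show "1 \<le> content UNIV" by (simp add: one)
qed

lemma content_empty: "content {} = 0"
proof -
  have "\<phi> = (\<lambda>x. 0)" if "\<phi> \<in> minorants {}" for \<phi>
    using that by (auto simp: minorants_def intro: antisym)
  then have "content {} \<le> ennreal (L (\<lambda>x. 0))"
    unfolding content_def by (intro SUP_least) (metis order_refl)
  then show ?thesis by (simp add: zero)
qed

text \<open>Here \<open>smooth\<close> enters the construction: capping a competitor by finitely
  many bumps leaves a remainder that decreases to 0, and additivity of \<open>L\<close> handles the
  capped part.\<close>

lemma content_countably_subadditive:
  assumes U: "\<And>i::nat. open (U i)"
  shows "content (\<Union>i. U i) \<le> (\<Sum>i. content (U i))"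
  unfolding content_def[of "\<Union>i. U i"]
proof (rule SUP_least)
  fix \<phi> assume \<phi>: "\<phi> \<in> minorants (\<Union>i. U i)"
  \<comment> \<open>One index controls both the number of sets and the steepness of the bumps, so
    that \<open>s k\<close> increases in k and a single monotone sequence can be fed to
    \<open>smooth\<close>.\<close>
  define s where "s k x = (\<Sum>i<k. bump (U i) k x)" for k x
  define \<psi> where "\<psi> k x = min (\<phi> x) (s k x)" for k x
  have s: "s k \<in> bcontfun" for k
    unfolding s_def by (intro sum_cont bump_bcontfun)
  have s0: "0 \<le> s k x" for k x unfolding s_def by (intro sum_nonneg bump_nonneg)
  have smono: "s k x \<le> s (Suc k) x" for k x
  proof -
    have "s k x \<le> (\<Sum>i<k. bump (U i) (Suc k) x)"
      unfolding s_def by (intro sum_mono bump_mono) simp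
    also have "\<dots> \<le> s (Suc k) x" by (simp add: s_def bump_nonneg)
    finally show ?thesis .
  qed
  have \<psi>: "\<psi> k \<in> bcontfun" for k unfolding \<psi>_def by (intro min_cont s minorantsD[OF \<phi>])
  have lim: "(\<lambda>k. \<phi> x - \<psi> k x) \<longlonglongrightarrow> 0" for x
  proof -
    have "eventually (\<lambda>k. \<phi> x - \<psi> k x = 0) sequentially"
    proof (cases "x \<in> (\<Union>i. U i)")
      case True
      then obtain i where i: "x \<in> U i" by auto
      show ?thesis
        using eventually_bump_eq_1[OF U i] eventually_gt_at_top[of i]
      proof eventually_elim
        case (elim k)
        have "bump (U i) k x \<le> s k x" unfolding s_def
          by (rule member_le_sum) (use elim in \<open>auto simp: bump_nonneg\<close>)
        with elim minorantsD(3)[OF \<phi>, of x] show ?case by (simp add: \<psi>_def)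
      qed
    next
      case False
      then show ?thesis using minorantsD(4)[OF \<phi>] s0 by (simp add: \<psi>_def)
    qed
    then show ?thesis by (rule tendsto_eventually)
  qed
  have "(\<lambda>k. L (\<lambda>x. \<phi> x - \<psi> k x)) \<longlonglongrightarrow> 0"
  proof (rule smooth[OF minus_cont[OF minorantsD(1)[OF \<phi>] \<psi>] _ _ _ lim])
    fix k x
    show "0 \<le> \<phi> x - \<psi> k x" "\<phi> x - \<psi> k x \<le> 1" "\<phi> x - \<psi> (Suc k) x \<le> \<phi> x - \<psi> k x"
      using smono[of k x] minorantsD(2,3)[OF \<phi>, of x] s0[of k x] by (auto simp: \<psi>_def)
  qed
  then have "(\<lambda>k. L \<phi> - L (\<lambda>x. \<phi> x - \<psi> k x)) \<longlonglongrightarrow> L \<phi> - 0" by (intro tendsto_intros)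
  then have "(\<lambda>k. ennreal (L (\<psi> k))) \<longlonglongrightarrow> ennreal (L \<phi>)"
    by (auto simp: diff[OF minorantsD(1)[OF \<phi>] \<psi>] intro: tendsto_ennrealI)
  then show "ennreal (L \<phi>) \<le> (\<Sum>i. content (U i))"
  proof (rule LIMSEQ_le_const2, intro exI allI impI)
    fix k
    have "L (\<psi> k) \<le> L (s k)" by (intro mono \<psi> s) (simp add: \<psi>_def)
    also have "\<dots> = (\<Sum>i<k. L (bump (U i) k))" unfolding s_def by (rule sum[OF bump_bcontfun])
    finally have "ennreal (L (\<psi> k)) \<le> ennreal (\<Sum>i<k. L (bump (U i) k))" by (rule ennreal_leI)
    also have "\<dots> = (\<Sum>i<k. ennreal (L (bump (U i) k)))"
      by (rule sum_ennreal[symmetric]) (rule minorantsD(5)[OF bump_minorants])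
    also have "\<dots> \<le> (\<Sum>i<k. content (U i))" by (intro sum_mono content_upper bump_minorants)
    also have "\<dots> \<le> (\<Sum>i. content (U i))" by (rule sum_le_suminf) auto
    finally show "ennreal (L (\<psi> k)) \<le> (\<Sum>i. content (U i))" .
  qed
qed

lemma outer_open: "open U \<Longrightarrow> outer U = content U"
  unfolding outer_def by (rule antisym) (auto intro!: INF_lower INF_greatest content_mono)

lemma outer_le_content: "open U \<Longrightarrow> A \<subseteq> U \<Longrightarrow> outer A \<le> content U"
  unfolding outer_def by (auto intro!: INF_lower)

lemma outer_mono: "A \<subseteq> B \<Longrightarrow> outer A \<le> outer B"
  unfolding outer_def by (rule INF_superset_mono) auto

lemma outer_le_1: "outer A \<le> 1"
  using outer_le_content[of UNIV A] content_UNIV by simp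

lemma outer_close:
  assumes "0 < e"
  obtains U where "open U" "A \<subseteq> U" "content U \<le> outer A + ennreal e"
proof -
  have "outer A < outer A + ennreal e"
    using le_less_trans[OF outer_le_1[of A] ennreal_one_less_top] assms by (simp add: ennreal_between)
  then show ?thesis using that
    unfolding outer_def[of A] by (subst (asm) INF_less_iff) (auto intro: less_imp_le)
qed

lemma outer_countably_subadditive: "outer (\<Union>i::nat. A i) \<le> (\<Sum>i. outer (A i))"
proof (rule ennreal_le_epsilon)
  fix e :: real assume e: "0 < e"
  have "\<exists>U. open U \<and> A i \<subseteq> U \<and> content U \<le> outer (A i) + ennreal (e * (1/2)^Suc i)" for i
    by (rule outer_close[of "e * (1/2)^Suc i" "A i"]) (use e in auto)
  then have "\<exists>U. \<forall>i. open (U i) \<and> A i \<subseteq> U i \<and> content (U i) \<le> outer (A i) + ennreal (e * (1/2)^Suc i)"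
    by (intro choice allI)
  then obtain U where U: "\<And>i. open (U i)" "\<And>i. A i \<subseteq> U i"
     "\<And>i. content (U i) \<le> outer (A i) + ennreal (e * (1/2)^Suc i)" by blast
  have "outer (\<Union>i. A i) \<le> content (\<Union>i. U i)" using U by (intro outer_le_content) blast+
  also have "\<dots> \<le> (\<Sum>i. content (U i))" by (rule content_countably_subadditive[OF U(1)])
  also have "\<dots> \<le> (\<Sum>i. outer (A i) + ennreal (e * (1/2)^Suc i))"
    by (intro suminf_le U) auto
  also have "\<dots> = (\<Sum>i. outer (A i)) + (\<Sum>i. ennreal (e * (1/2)^Suc i))"
    by (rule suminf_add[symmetric]) auto
  also have "(\<Sum>i. ennreal (e * (1/2)^Suc i)) = ennreal e"
    using e sums_mult[OF power_half_series, of e] by (intro suminf_ennreal_eq) auto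
  finally show "outer (\<Union>i. A i) \<le> (\<Sum>i. outer (A i)) + ennreal e" .
qed

lemma outer_measure_space_outer: "outer_measure_space UNIV outer"
  unfolding outer_measure_space_def positive_def increasing_def countably_subadditive_def
  using outer_open[of "{}"] content_empty outer_mono outer_countably_subadditive by auto

text \<open>
  A competitor \<open>\<phi>\<close> for \<open>V \<inter> U\<close> is almost unchanged when replaced by \<open>max 0 (\<phi> - \<epsilon>)\<close>, which
  leaves room for competitors on the open set \<open>{x \<in> V. \<phi> x < \<epsilon>} \<supseteq> V - U\<close>.
\<close>
lemma content_split:
  assumes U: "open U" and V: "open V"
  shows "content (V \<inter> U) + outer (V - U) \<le> content V"
proof -
  have *: "ennreal (L \<phi>) + outer (V - U) \<le> content V" if \<phi>: "\<phi> \<in> minorants (V \<inter> U)" for \<phi>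
  proof (rule ennreal_le_epsilon)
    fix e :: real assume e: "0 < e"
    define W where "W = V \<inter> {x. \<phi> x < e}"
    define \<phi>' where "\<phi>' x = max 0 (\<phi> x - e)" for x
    have W: "open W" unfolding W_def
      by (intro open_Int V open_Collect_less continuous_intros bcontfun_continuous minorantsD[OF \<phi>])
    have \<phi>': "\<phi>' \<in> bcontfun" unfolding \<phi>'_def
      by (intro max_cont minus_cont minorantsD[OF \<phi>] const_bcontfun)
    have WV: "V - U \<subseteq> W" using minorantsD(4)[OF \<phi>] e by (auto simp: W_def)
    have "L \<phi> \<le> L (\<lambda>x. \<phi>' x + e)"
      by (intro mono plus_cont minorantsD[OF \<phi>] \<phi>' const_bcontfun) (auto simp: \<phi>'_def)
    then have 1: "L \<phi> \<le> L \<phi>' + e" by (simp add: add[OF \<phi>' const_bcontfun] const)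
    have \<phi>'0: "0 \<le> L \<phi>'" by (intro nonneg \<phi>') (simp add: \<phi>'_def)
    have 2: "ennreal (L \<phi>' + L \<eta>) \<le> content V" if \<eta>: "\<eta> \<in> minorants W" for \<eta>
    proof -
      have "(\<lambda>x. \<phi>' x + \<eta> x) \<in> minorants V"
      proof (rule minorantsI[OF plus_cont[OF \<phi>' minorantsD(1)[OF \<eta>]]])
        fix x
        show "0 \<le> \<phi>' x + \<eta> x" using minorantsD(2)[OF \<eta>, of x] by (simp add: \<phi>'_def)
        \<comment> \<open>The two summands are never positive together: \<open>\<phi>'\<close>
          vanishes where \<phi> < e, and \<eta> vanishes where \<phi> \<ge> e.\<close>
        show "\<phi>' x + \<eta> x \<le> 1" if "x \<in> V"
        proof (cases "\<phi> x < e")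
          case True
          then show ?thesis using minorantsD(3)[OF \<eta>, of x] by (simp add: \<phi>'_def)
        next
          case False
          then have "\<eta> x = 0" by (intro minorantsD(4)[OF \<eta>]) (simp add: W_def)
          then show ?thesis using minorantsD(3)[OF \<phi>, of x] e by (simp add: \<phi>'_def)
        qed
        show "\<phi>' x + \<eta> x = 0" if "x \<notin> V"
          using minorantsD(4)[OF \<eta>, of x] minorantsD(4)[OF \<phi>, of x] that e by (simp add: \<phi>'_def W_def)
      qed
      from content_upper[OF this] show ?thesis by (simp add: add[OF \<phi>' minorantsD(1)[OF \<eta>]])
    qed
    have "ennreal (L \<phi>) + outer (V - U) \<le> ennreal (L \<phi>' + e) + content W"
      by (intro add_mono ennreal_leI 1 outer_le_content W WV)
    also have "\<dots> = (ennreal (L \<phi>') + content W) + ennreal e"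
      using \<phi>'0 e by (simp add: ac_simps)
    also have "ennreal (L \<phi>') + content W = (SUP \<eta>\<in>minorants W. ennreal (L \<phi>') + ennreal (L \<eta>))"
      unfolding content_def by (rule ennreal_SUP_add_right[OF minorants_nonempty])
    also have "\<dots> \<le> content V"
      by (intro SUP_least) (use 2 \<phi>'0 in \<open>auto simp: minorantsD(5) simp flip: ennreal_plus\<close>)
    finally show "ennreal (L \<phi>) + outer (V - U) \<le> content V + ennreal e" by simp
  qed
  have "content (V \<inter> U) + outer (V - U) = (SUP \<phi>\<in>minorants (V \<inter> U). ennreal (L \<phi>) + outer (V - U))"
    unfolding content_def by (rule ennreal_SUP_add_left[OF minorants_nonempty, symmetric])
  also have "\<dots> \<le> content V" by (intro SUP_least *)
  finally show ?thesis .
qed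

text \<open>Since \<open>outer A\<close> is an infimum over open supersets V of A, Caratheodory's
  criterion for arbitrary A reduces to \<open>content_split\<close> for V.\<close>

lemma open_in_lambda_system:
  assumes U: "open U"
  shows "U \<in> lambda_system UNIV UNIV outer"
proof -
  have "outer (U \<inter> A) + outer (- U \<inter> A) = outer A" for A
  proof (rule antisym)
    have "outer (U \<inter> A) + outer (- U \<inter> A) \<le> content V" if V: "open V" "A \<subseteq> V" for V
    proof -
      have "outer (U \<inter> A) + outer (- U \<inter> A) \<le> content (V \<inter> U) + outer (V - U)"
        using V U by (intro add_mono outer_le_content outer_mono) auto
      also have "\<dots> \<le> content V" by (rule content_split[OF U V(1)])
      finally show ?thesis .
    qed
    then show "outer (U \<inter> A) + outer (- U \<inter> A) \<le> outer A"
      unfolding outer_def[of A] by (auto intro!: INF_greatest)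
    have "subadditive UNIV outer"
      using outer_measure_space_outer
        algebra.axioms(1)[OF sigma_algebra.axioms(1)[OF sigma_algebra_Pow[of UNIV]]]
      by (auto simp: outer_measure_space_def intro: ring_of_sets.countably_subadditive_subadditive)
    then have "outer ((U \<inter> A) \<union> (- U \<inter> A)) \<le> outer (U \<inter> A) + outer (- U \<inter> A)"
      by (auto simp: subadditive_def)
    moreover have "(U \<inter> A) \<union> (- U \<inter> A) = A" by auto
    ultimately show "outer A \<le> outer (U \<inter> A) + outer (- U \<inter> A)" by simp
  qed
  then show ?thesis by (auto simp: lambda_system_def Compl_eq_Diff_UNIV)
qed

lemma borel_outer_measure:
  obtains \<mu> where "\<mu> \<in> space (prob_algebra borel)" "\<And>U. open U \<Longrightarrow> emeasure \<mu> U = content U"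
proof -
  define \<Lambda> where "\<Lambda> = lambda_system UNIV UNIV outer"
  have ms: "measure_space UNIV \<Lambda> outer"
    unfolding \<Lambda>_def using sigma_algebra.caratheodory_lemma[OF sigma_algebra_Pow[of UNIV]] outer_measure_space_outer by simp
  then have "sigma_algebra UNIV \<Lambda>" by (simp add: measure_space_def)
  then have "sets borel \<subseteq> \<Lambda>"
    unfolding sets_borel by (rule sigma_algebra.sigma_sets_subset) (auto simp: \<Lambda>_def open_in_lambda_system)
  with ms have ms': "measure_space UNIV (sets borel) outer"
    using sets.sigma_algebra_axioms[of "borel :: 'a measure"] by (auto intro: measure_down)
  define \<mu> where "\<mu> = measure_of UNIV (sets borel) outer"
  have s: "sets \<mu> = sets borel" unfolding \<mu>_def by (metis sets.sets_measure_of_eq space_borel)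
  have e: "emeasure \<mu> A = outer A" if "A \<in> sets borel" for A
    unfolding \<mu>_def using ms' that by (intro emeasure_measure_of_sigma) (auto simp: measure_space_def)
  have "prob_space \<mu>"
    using sets_eq_imp_space_eq[OF s] by (intro prob_spaceI) (simp add: e outer_open content_UNIV)
  then show ?thesis using s e by (intro that) (auto simp: space_prob_algebra outer_open)
qed

text \<open>A layer-cake argument: \<phi> is cut into N slices, and comparing each slice with the
  one below it costs a single slice, that is 1/N.\<close>

theorem representation:
  obtains \<mu> where "\<mu> \<in> space (prob_algebra borel)" "\<And>\<phi>. \<phi> \<in> bcontfun \<Longrightarrow> (\<integral>x. \<phi> x \<partial>\<mu>) = L \<phi>"
proof -
  obtain \<mu> where \<mu>: "\<mu> \<in> space (prob_algebra borel)" and em: "\<And>U. open U \<Longrightarrow> emeasure \<mu> U = content U"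
    using borel_outer_measure by metis
  have s[measurable_cong]: "sets \<mu> = sets borel" and "prob_space \<mu>"
    using \<mu> by (auto simp: space_prob_algebra)
  interpret prob_space \<mu> by fact
  note int = integrable_bcontfun[OF \<mu>]
  have 1: "L \<phi> \<le> (\<integral>x. \<phi> x \<partial>\<mu>)" if \<phi>: "\<phi> \<in> bcontfun" and b: "\<And>x. 0 \<le> \<phi> x" "\<And>x. \<phi> x \<le> 1" for \<phi>
  proof -
    have "L \<phi> \<le> (\<integral>x. \<phi> x \<partial>\<mu>) + 1 / real (Suc k)" for k
    proof -
      define N where "N = Suc k"
      \<comment> \<open>Slice i of \<open>real N * \<phi>\<close>: the part between the heights i
        and i + 1.\<close>
      define p where "p i x = max 0 (min 1 (real N * \<phi> x - real i))" for i x
      have p: "p i \<in> bcontfun" for i unfolding p_def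
        by (intro max_cont min_cont minus_cont mult_cont const_bcontfun \<phi>)
      have sum_p: "(\<Sum>i<n. p i x) = min (real n) (real N * \<phi> x)" for n x
      proof (induction n)
        case 0
        have "0 \<le> real N * \<phi> x" using b by simp
        then show ?case by simp
      next
        case (Suc n)
        have "min (real n) y + max 0 (min 1 (y - real n)) = min (real (Suc n)) y" for y :: real
          by (simp add: min_def max_def)
        then show ?case unfolding sum.lessThan_Suc Suc by (simp add: p_def)
      qed
      \<comment> \<open>Slice \<open>Suc i\<close> vanishes outside U, and slice i is already 1 on
        U, so the mass of U separates the two.\<close>
      have step: "L (p (Suc i)) \<le> (\<integral>x. p i x \<partial>\<mu>)" for i
      proof -
        define U where "U = {x. real (Suc i) < real N * \<phi> x}"
        have U: "open U" unfolding U_def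
          by (intro open_Collect_less continuous_intros bcontfun_continuous \<phi>)
        have [measurable]: "U \<in> sets borel" using U by simp
        have intU: "integrable \<mu> (indicator U :: 'a \<Rightarrow> real)"
          by (intro integrable_real_indicator) (simp_all add: s less_top[symmetric])
        have "p (Suc i) \<in> minorants U" by (rule minorantsI[OF p]) (auto simp: p_def U_def)
        then have "ennreal (L (p (Suc i))) \<le> emeasure \<mu> U" using em[OF U] content_upper by simp
        then have "L (p (Suc i)) \<le> measure \<mu> U"
          by (simp add: emeasure_eq_measure)
        also have "\<dots> = (\<integral>x. indicator U x \<partial>\<mu>)" using sets_eq_imp_space_eq[OF s] by simp
        also have "\<dots> \<le> (\<integral>x. p i x \<partial>\<mu>)"
          by (intro integral_mono int[OF p] intU) (auto simp: U_def p_def indicator_def less_top[symmetric])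
        finally show ?thesis .
      qed
      have p1: "L (p i) \<le> 1" for i
        using mono[OF p const_bcontfun, of i 1] by (simp add: one p_def)
      have \<phi>N: "\<phi> x = (1 / real N) * (\<Sum>i<N. p i x)" for x
      proof -
        have "real N * \<phi> x \<le> real N" using b[of x] by (simp add: mult_left_le)
        then show ?thesis by (simp add: sum_p N_def)
      qed
      have "L \<phi> = (1 / real N) * (\<Sum>i<N. L (p i))"
        unfolding \<phi>N[abs_def] by (subst scale) (simp_all add: sum p sum_cont)
      \<comment> \<open>The bottom slice has no slice below it and is bounded by 1; after division
        by N this is the whole error.\<close>
      also have "(\<Sum>i<N. L (p i)) = L (p 0) + (\<Sum>i<k. L (p (Suc i)))"
        unfolding N_def by (rule sum.lessThan_Suc_shift)
      also have "\<dots> \<le> 1 + (\<Sum>i<k. \<integral>x. p i x \<partial>\<mu>)"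
        by (intro add_mono p1 sum_mono step)
      also have "(\<Sum>i<k. \<integral>x. p i x \<partial>\<mu>) \<le> (\<Sum>i<N. \<integral>x. p i x \<partial>\<mu>)"
        by (simp add: N_def) (auto intro: integral_nonneg_AE simp: p_def)
      also have "\<dots> = (\<integral>x. (\<Sum>i<N. p i x) \<partial>\<mu>)"
        by (rule Bochner_Integration.integral_sum[symmetric]) (rule int[OF p])
      finally have "L \<phi> \<le> 1 / real N * (1 + (\<integral>x. (\<Sum>i<N. p i x) \<partial>\<mu>))" by (simp add: mult_left_mono divide_right_mono)
      also have "\<dots> = (\<integral>x. (1 / real N) * (\<Sum>i<N. p i x) \<partial>\<mu>) + 1 / real N"
        by (simp add: algebra_simps add_divide_distrib)
      also have "\<dots> = (\<integral>x. \<phi> x \<partial>\<mu>) + 1 / real N" by (simp only: \<phi>N[symmetric])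
      finally show ?thesis by (simp add: N_def)
    qed
    moreover have "(\<lambda>k. (\<integral>x. \<phi> x \<partial>\<mu>) + 1 / real (Suc k)) \<longlonglongrightarrow> (\<integral>x. \<phi> x \<partial>\<mu>) + 0"
      by (intro tendsto_intros LIMSEQ_Suc lim_inverse_n')
    ultimately show ?thesis by (auto intro: LIMSEQ_le_const)
  qed
  have 2: "(\<integral>x. \<phi> x \<partial>\<mu>) = L \<phi>" if \<phi>: "\<phi> \<in> bcontfun" and b: "\<And>x. 0 \<le> \<phi> x" "\<And>x. \<phi> x \<le> 1" for \<phi>
  proof (rule antisym[OF _ 1[OF that]])
    \<comment> \<open>\<open>L\<close> and the integral agree on the constant 1, so the upper bound
      for 1 - \<phi> is the lower bound for \<phi>.\<close>
    have "L (\<lambda>x. 1 - \<phi> x) \<le> (\<integral>x. 1 - \<phi> x \<partial>\<mu>)"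
      using b by (intro 1 minus_cont const_bcontfun \<phi>) auto
    then show "(\<integral>x. \<phi> x \<partial>\<mu>) \<le> L \<phi>"
      using int[OF \<phi>] by (simp add: diff[OF const_bcontfun \<phi>] one prob_space)
  qed
  show ?thesis
  proof (rule that[OF \<mu>])
    fix \<phi> :: "'a \<Rightarrow> real" assume \<phi>: "\<phi> \<in> bcontfun"
    obtain C where C: "C > 0" "\<And>x. \<bar>\<phi> x\<bar> \<le> C" using bcontfun_bounded[OF \<phi>] by metis
    define \<psi> where "\<psi> x = 1 / (2 * C) * \<phi> x + 1 / 2" for x
    have \<psi>: "\<psi> \<in> bcontfun" unfolding \<psi>_def by (intro plus_cont mult_cont \<phi> const_bcontfun)
    have b: "0 \<le> \<psi> x" "\<psi> x \<le> 1" for x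
      using C(1) C(2)[of x] by (auto simp: \<psi>_def field_simps abs_le_iff)
    have "(\<integral>x. \<psi> x \<partial>\<mu>) = L \<psi>" by (rule 2[OF \<psi> b])
    then have "1 / (2 * C) * (\<integral>x. \<phi> x \<partial>\<mu>) + 1 / 2 = 1 / (2 * C) * L \<phi> + 1 / 2"
      unfolding \<psi>_def add[OF mult_cont[OF \<phi>] const_bcontfun] scale[OF \<phi>] const
      using int[OF \<phi>] by (simp add: prob_space)
    then show "(\<integral>x. \<phi> x \<partial>\<mu>) = L \<phi>" using C(1) by simp
  qed
qed

end

subsection \<open>Equicontinuous Markov chains with a uniform lower bound\<close>

text \<open>A supremum keeps only non-strict bounds; strictness comes from a finite positive b
  strictly below a, which also covers a = \<infinity>.\<close>

lemma tendsto_SUP_ennreal_zeroI: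
  fixes f :: "nat \<Rightarrow> 'b \<Rightarrow> real"
  assumes "\<And>e. 0 < e \<Longrightarrow> eventually (\<lambda>n. \<forall>x\<in>S. \<bar>f n x\<bar> \<le> e) sequentially"
  shows "(\<lambda>n. SUP x\<in>S. ennreal \<bar>f n x\<bar>) \<longlonglongrightarrow> 0"
proof (rule order_tendstoI)
  fix a :: ennreal assume "0 < a"
  then obtain b where b: "0 < b" "b < a" using dense by blast
  then obtain e where e: "b = ennreal e" "0 < e"
    by (cases b) (auto simp: ennreal_less_zero_iff)
  show "eventually (\<lambda>n. (SUP x\<in>S. ennreal \<bar>f n x\<bar>) < a) sequentially"
    using assms[OF e(2)]
  proof eventually_elim
    case (elim n)
    then have "(SUP x\<in>S. ennreal \<bar>f n x\<bar>) \<le> b"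
      unfolding e(1) by (intro SUP_least ennreal_leI) auto
    with b(2) show ?case by (rule le_less_trans[rotated])
  qed
qed simp

lemma equicontinuous_atD:
  fixes f :: "'i \<Rightarrow> 'a::metric_space \<Rightarrow> real"
  assumes "equicontinuous_at I f x" "0 < e"
  obtains d where "0 < d" "\<And>y i. dist y x < d \<Longrightarrow> i \<in> I \<Longrightarrow> \<bar>f i y - f i x\<bar> < e"
proof -
  have "eventually (\<lambda>y. (SUP i\<in>I. ennreal \<bar>f i y - f i x\<bar>) < ennreal e) (at x)"
    using assms unfolding equicontinuous_at_def by (intro order_tendstoD(2)) auto
  then obtain d where d: "0 < d"
    "\<And>y. y \<noteq> x \<Longrightarrow> dist y x < d \<Longrightarrow> (SUP i\<in>I. ennreal \<bar>f i y - f i x\<bar>) < ennreal e"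
    unfolding eventually_at by auto
  have "\<bar>f i y - f i x\<bar> < e" if "dist y x < d" "i \<in> I" for y i
  proof (cases "y = x")
    case False
    have "ennreal \<bar>f i y - f i x\<bar> \<le> (SUP i\<in>I. ennreal \<bar>f i y - f i x\<bar>)"
      using that by (intro SUP_upper)
    also note d(2)[OF False that(1)]
    finally show ?thesis by (simp add: ennreal_less_iff)
  qed (use assms in simp)
  with d(1) show ?thesis by (rule that)
qed

text \<open>
  The residual probability \<open>\<rho>\<close> is \<open>(\<mu> - a \<nu>) / (1 - a)\<close>, where \<open>\<nu>\<close> is \<open>\<mu>\<close> conditioned on \<open>B\<close>.
\<close>
lemma residual_measure:
  fixes \<mu> :: "'a::metric_space measure"
  assumes \<mu>: "\<mu> \<in> space (prob_algebra borel)" and B: "B \<in> sets borel"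
    and a: "0 < a" "a < 1" and aB: "a \<le> measure \<mu> B"
  obtains \<rho> where "\<rho> \<in> space (prob_algebra borel)"
    "\<And>f c \<delta>. f \<in> bcontfun \<Longrightarrow> (\<And>y. y \<in> B \<Longrightarrow> \<bar>f y - c\<bar> \<le> \<delta>) \<Longrightarrow>
       \<bar>(\<integral>x. f x \<partial>\<mu>) - (a * c + (1 - a) * (\<integral>x. f x \<partial>\<rho>))\<bar> \<le> a * \<delta>"
proof -
  have s[measurable_cong]: "sets \<mu> = sets borel" and "prob_space \<mu>"
    using \<mu> by (auto simp: space_prob_algebra)
  interpret prob_space \<mu> by fact
  note [measurable] = B
  define m where "m = measure \<mu> B"
  \<comment> \<open>The density of \<rho> with respect to \<mu>. It is nonnegative on B because
    \<open>a \<le> m\<close>.\<close>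
  define g where "g x = (1 - a / m * indicator B x) / (1 - a)" for x
  define \<rho> where "\<rho> = density \<mu> g"
  have m: "0 < m" "a \<le> m" using a aB by (auto simp: m_def)
  have g: "0 \<le> g x" for x
    using a m by (auto simp: g_def indicator_def field_simps)
  have gm[measurable]: "g \<in> borel_measurable \<mu>" unfolding g_def[abs_def] by measurable
  have iB: "integrable \<mu> (indicator B :: 'a \<Rightarrow> real)"
    by (intro integrable_real_indicator) (simp_all add: B s less_top[symmetric])
  have mB: "(\<integral>x. indicator B x \<partial>\<mu>) = m"
    using sets_eq_imp_space_eq[OF s] by (simp add: m_def)
  have ig: "integrable \<mu> g" unfolding g_def[abs_def] using iB by simp
  have "(\<integral>x. g x \<partial>\<mu>) = 1"
    unfolding g_def using iB a m by (simp add: prob_space flip: m_def)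
  then have "emeasure \<rho> (space \<rho>) = 1"
    unfolding \<rho>_def using ig g by (simp add: emeasure_density nn_integral_eq_integral cong: nn_integral_cong)
  then have "prob_space \<rho>" by (rule prob_spaceI)
  then have \<rho>: "\<rho> \<in> space (prob_algebra borel)"
    by (simp add: space_prob_algebra \<rho>_def s)
  show ?thesis
  proof (rule that[OF \<rho>])
    fix f :: "'a \<Rightarrow> real" and c \<delta> :: real
    assume f: "f \<in> bcontfun" and near: "\<And>y. y \<in> B \<Longrightarrow> \<bar>f y - c\<bar> \<le> \<delta>"
    have fm[measurable]: "f \<in> borel_measurable borel" by (rule bcontfun_measurable[OF f])
    have intf: "integrable \<mu> f" by (rule integrable_bcontfun[OF \<mu> f])
    have ifB: "integrable \<mu> (\<lambda>x. indicator B x * f x)"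
      using integrable_mult_indicator[OF _ intf, of B] by (simp add: s B)
    have ifc: "integrable \<mu> (\<lambda>x. indicator B x * (f x - c))"
      using Bochner_Integration.integrable_diff[OF ifB integrable_mult_left[OF iB, of c]]
      by (simp add: algebra_simps)
    have "(\<integral>x. f x \<partial>\<rho>) = (\<integral>x. g x * f x \<partial>\<mu>)"
      unfolding \<rho>_def using g by (subst integral_density) auto
    also have "\<dots> = (\<integral>x. (f x - a / m * (indicator B x * f x)) / (1 - a) \<partial>\<mu>)"
      by (intro Bochner_Integration.integral_cong) (simp_all add: g_def algebra_simps)
    also have "\<dots> = ((\<integral>x. f x \<partial>\<mu>) - a / m * (\<integral>x. indicator B x * f x \<partial>\<mu>)) / (1 - a)"
      using intf ifB by simp
    finally have "(1 - a) * (\<integral>x. f x \<partial>\<rho>) = (\<integral>x. f x \<partial>\<mu>) - a / m * (\<integral>x. indicator B x * f x \<partial>\<mu>)"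
      using a by simp
    moreover have "(\<integral>x. indicator B x * f x \<partial>\<mu>) = (\<integral>x. indicator B x * (f x - c) \<partial>\<mu>) + m * c"
    proof -
      have "(\<integral>x. indicator B x * f x \<partial>\<mu>) = (\<integral>x. indicator B x * (f x - c) + indicator B x * c \<partial>\<mu>)"
        by (intro Bochner_Integration.integral_cong) (simp_all add: algebra_simps)
      also have "\<dots> = (\<integral>x. indicator B x * (f x - c) \<partial>\<mu>) + m * c"
        using ifc iB by (simp add: m_def)
      finally show ?thesis .
    qed
    ultimately have *: "(\<integral>x. f x \<partial>\<mu>) - (a * c + (1 - a) * (\<integral>x. f x \<partial>\<rho>))
        = a / m * (\<integral>x. indicator B x * (f x - c) \<partial>\<mu>)"
      using m by (simp only: distrib_left) simp
    have "\<bar>\<integral>x. indicator B x * (f x - c) \<partial>\<mu>\<bar> \<le> (\<integral>x. \<bar>indicator B x * (f x - c)\<bar> \<partial>\<mu>)"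
      using integral_norm_bound[of \<mu> "\<lambda>x. indicator B x * (f x - c)"] by simp
    also have "\<dots> \<le> (\<integral>x. indicator B x * \<delta> \<partial>\<mu>)"
    proof (rule integral_mono)
      show "integrable \<mu> (\<lambda>x. \<bar>indicator B x * (f x - c)\<bar>)" using ifc by (rule integrable_abs)
      show "integrable \<mu> (\<lambda>x. indicator B x * \<delta>)" using iB by simp
      show "\<bar>indicator B x * (f x - c)\<bar> \<le> indicator B x * \<delta>" for x
        using near[of x] by (cases "x \<in> B") auto
    qed
    also have "\<dots> = m * \<delta>" by (simp add: m_def)
    finally have "a / m * \<bar>\<integral>x. indicator B x * (f x - c) \<partial>\<mu>\<bar> \<le> a / m * (m * \<delta>)"
      using a m by (intro mult_left_mono) auto
    then show "\<bar>(\<integral>x. f x \<partial>\<mu>) - (a * c + (1 - a) * (\<integral>x. f x \<partial>\<rho>))\<bar> \<le> a * \<delta>"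
      unfolding * using a m by (simp add: abs_mult)
  qed
qed

section \<open>The Markov operator and its powers on bounded continuous functions\<close>

locale equicontinuous_chain =
  fixes \<pi> :: "'a::metric_space \<Rightarrow> 'a measure" and z :: 'a
  assumes kernel: "transition_function \<pi>"
    and lower: "\<And>\<epsilon>. 0 < \<epsilon> \<Longrightarrow> \<exists>\<alpha>::real. \<alpha> > 0 \<and>
           (\<forall>x. liminf (\<lambda>n. emeasure (iterate \<pi> n x) (ball z \<epsilon>)) \<ge> ennreal \<alpha>)"
    and equicont: "\<And>\<phi> x. \<phi> \<in> bcontfun \<Longrightarrow>
           equicontinuous_at {n::nat. n \<ge> 1} (\<lambda>n x. \<integral>y. \<phi> y \<partial>iterate \<pi> n x) x"
begin

text \<open>The n-th power of the Markov operator applied to \<phi>, with the identity at n =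
  0.\<close>

definition E :: "('a \<Rightarrow> real) \<Rightarrow> nat \<Rightarrow> 'a \<Rightarrow> real" where
  "E \<phi> n x = (\<integral>y. \<phi> y \<partial>iterate \<pi> n x)"

lemma iterate_space: "iterate \<pi> n x \<in> space (prob_algebra borel)"
  using measurable_space[OF transition_function_iterate[OF kernel]] by simp

lemma prob_space_iterate: "prob_space (iterate \<pi> n x)"
  and sets_iterate: "sets (iterate \<pi> n x) = sets borel"
  using iterate_space by (auto simp: space_prob_algebra)

lemma iterate_subprob:
  assumes "\<mu> \<in> space (prob_algebra borel)"
  shows "iterate \<pi> n \<in> \<mu> \<rightarrow>\<^sub>M subprob_algebra borel"
proof -
  have "sets \<mu> = sets borel" using assms by (simp add: space_prob_algebra)
  from measurable_cong_sets[OF this refl] show ?thesis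
    using measurable_prob_algebraD[OF transition_function_iterate[OF kernel, of n]] by blast
qed

lemma bind_iterate_space:
  assumes "\<mu> \<in> space (prob_algebra borel)"
  shows "\<mu> \<bind> iterate \<pi> n \<in> space (prob_algebra borel)"
  using prob_space_bind'[OF assms transition_function_iterate[OF kernel]]
    sets_bind'[OF assms transition_function_iterate[OF kernel]]
  by (simp add: space_prob_algebra)

lemma return_space: "return borel x \<in> space (prob_algebra borel)"
  by (simp add: space_prob_algebra prob_space_return)

lemma integral_bind_iterate:
  assumes \<mu>: "\<mu> \<in> space (prob_algebra borel)" and \<phi>: "\<phi> \<in> bcontfun"
  shows "(\<integral>x. \<phi> x \<partial>(\<mu> \<bind> iterate \<pi> n)) = (\<integral>x. E \<phi> n x \<partial>\<mu>)"
proof -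
  obtain C where C: "\<And>x. \<bar>\<phi> x\<bar> \<le> C" using bcontfun_bounded[OF \<phi>] by metis
  have "finite_measure \<mu>" using \<mu> by (simp add: space_prob_algebra prob_space.finite_measure)
  moreover have "emeasure (iterate \<pi> n x) (space (iterate \<pi> n x)) \<le> ennreal 1" for x
    using prob_space.emeasure_space_1[OF prob_space_iterate, of n x] by simp
  ultimately show ?thesis
    unfolding E_def
    by (intro integral_bind[where B=C and B'=1 and K=borel] bcontfun_measurable[OF \<phi>] C iterate_subprob[OF \<mu>] AE_I2)
qed

lemma integral_return_borel: "f \<in> borel_measurable borel \<Longrightarrow> (\<integral>y. f y \<partial>return borel x) = f x" for f :: "'a \<Rightarrow> real"
  by (rule integral_return) auto

lemma E_0: "\<phi> \<in> bcontfun \<Longrightarrow> E \<phi> 0 x = \<phi> x"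
  by (simp add: E_def integral_return_borel bcontfun_measurable)

lemma integrable_iterate: "\<phi> \<in> bcontfun \<Longrightarrow> integrable (iterate \<pi> n x) \<phi>" for \<phi> :: "'a \<Rightarrow> real"
  by (rule integrable_bcontfun[OF iterate_space])

lemma E_const: "E (\<lambda>x. c) n x = c"
  by (simp add: E_def prob_space.prob_space[OF prob_space_iterate])

lemma E_mono: "\<phi> \<in> bcontfun \<Longrightarrow> \<psi> \<in> bcontfun \<Longrightarrow> (\<And>x. \<phi> x \<le> \<psi> x) \<Longrightarrow> E \<phi> n x \<le> E \<psi> n x"
  unfolding E_def by (intro integral_mono integrable_iterate)

lemma E_plus: "\<phi> \<in> bcontfun \<Longrightarrow> \<psi> \<in> bcontfun \<Longrightarrow> E (\<lambda>x. \<phi> x + \<psi> x) n x = E \<phi> n x + E \<psi> n x"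
  unfolding E_def by (intro Bochner_Integration.integral_add integrable_iterate)

lemma E_minus: "\<phi> \<in> bcontfun \<Longrightarrow> \<psi> \<in> bcontfun \<Longrightarrow> E (\<lambda>x. \<phi> x - \<psi> x) n x = E \<phi> n x - E \<psi> n x"
  unfolding E_def by (intro Bochner_Integration.integral_diff integrable_iterate)

lemma E_mult: "E (\<lambda>x. c * \<phi> x) n x = c * E \<phi> n x"
  unfolding E_def by simp

lemma E_abs_le:
  assumes \<phi>: "\<phi> \<in> bcontfun" and C: "\<And>x. \<bar>\<phi> x\<bar> \<le> C"
  shows "\<bar>E \<phi> n x\<bar> \<le> C"
proof -
  have "E \<phi> n x \<le> E (\<lambda>x. C) n x" "E (\<lambda>x. - C) n x \<le> E \<phi> n x"
    using C by (intro E_mono \<phi> const_bcontfun; simp add: abs_le_iff minus_le_iff)+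
  then show ?thesis by (simp add: E_const abs_le_iff)
qed

lemma E_nonneg: "\<phi> \<in> bcontfun \<Longrightarrow> (\<And>x. 0 \<le> \<phi> x) \<Longrightarrow> 0 \<le> E \<phi> n x"
  unfolding E_def by (intro integral_nonneg_AE AE_I2)

text \<open>The hypothesis speaks of n \<ge> 1; continuity of \<phi> adds n = 0, so that later
  splittings of times need no positivity.\<close>

lemma equicont_dist:
  assumes \<phi>: "\<phi> \<in> bcontfun" and e: "0 < e"
  obtains d where "0 < d" "\<And>y n. dist y x < d \<Longrightarrow> \<bar>E \<phi> n y - E \<phi> n x\<bar> < e"
proof -
  obtain d1 where d1: "0 < d1" "\<And>y n. dist y x < d1 \<Longrightarrow> 1 \<le> n \<Longrightarrow> \<bar>E \<phi> n y - E \<phi> n x\<bar> < e"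
    using equicontinuous_atD[OF equicont[OF \<phi>] e, of x] unfolding E_def by auto
  obtain d2 where d2: "0 < d2" "\<And>y. dist y x < d2 \<Longrightarrow> \<bar>\<phi> y - \<phi> x\<bar> < e"
    using bcontfun_continuous[OF \<phi>] e unfolding continuous_on_iff dist_real_def by (metis UNIV_I)
  show ?thesis
  proof (rule that[of "min d1 d2"])
    fix y n assume "dist y x < min d1 d2"
    then show "\<bar>E \<phi> n y - E \<phi> n x\<bar> < e"
      using d1(2)[of y n] d2(2)[of y] by (cases n) (auto simp: E_0[OF \<phi>])
  qed (use d1 d2 in simp)
qed

text \<open>The Feller property, obtained here from equicontinuity.\<close>

lemma E_bcontfun:
  assumes \<phi>: "\<phi> \<in> bcontfun"
  shows "E \<phi> n \<in> bcontfun"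
proof -
  obtain C where C: "\<And>x. \<bar>\<phi> x\<bar> \<le> C" using bcontfun_bounded[OF \<phi>] by metis
  show ?thesis
  proof (rule bcontfun_normI)
    show "continuous_on UNIV (E \<phi> n)"
      unfolding continuous_on_iff dist_real_def using equicont_dist[OF \<phi>] by metis
    show "norm (E \<phi> n x) \<le> C" for x using E_abs_le[OF \<phi> C] by simp
  qed
qed

lemma iterate_add: "iterate \<pi> (m + n) x = iterate \<pi> m x \<bind> iterate \<pi> n"
proof (induction m arbitrary: x)
  case 0
  show ?case
    using bind_return[OF measurable_prob_algebraD[OF transition_function_iterate[OF kernel]], of x n] by simp
next
  case (Suc m)
  have "\<pi> x \<in> space (prob_algebra borel)" using measurable_space[OF kernel] by simp
  note assoc = bind_assoc[OF iterate_subprob[OF this] measurable_prob_algebraD[OF transition_function_iterate[OF kernel]]]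
  have "iterate \<pi> (m + n) = (\<lambda>y. iterate \<pi> m y \<bind> iterate \<pi> n)"
    by (rule ext) (rule Suc)
  then show ?case by (simp add: assoc)
qed

lemma E_E: "\<phi> \<in> bcontfun \<Longrightarrow> E (E \<phi> n) m x = E \<phi> (m + n) x"
  unfolding E_def[of "E \<phi> n"] E_def[of \<phi> "m + n"] iterate_add
  by (rule integral_bind_iterate[OF iterate_space, symmetric])

lemma integral_E_add:
  assumes \<mu>: "\<mu> \<in> space (prob_algebra borel)" and \<phi>: "\<phi> \<in> bcontfun"
  shows "(\<integral>x. E \<phi> (m + n) x \<partial>\<mu>) = (\<integral>x. E \<phi> n x \<partial>(\<mu> \<bind> iterate \<pi> m))"
  by (simp add: integral_bind_iterate[OF \<mu> E_bcontfun[OF \<phi>]] E_E[OF \<phi>])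

section \<open>Merging of the laws from different initial distributions\<close>

text \<open>Fatou's lemma carries the pointwise lower bound over to any initial law. The time after
  which it holds depends on \<mu>, but \<alpha> does not.\<close>

lemma eventually_ball_mass:
  assumes \<epsilon>: "0 < \<epsilon>"
  obtains \<alpha> where "0 < \<alpha>" "\<alpha> < 1"
    "\<And>\<mu>. \<mu> \<in> space (prob_algebra borel) \<Longrightarrow>
      eventually (\<lambda>n. \<alpha> \<le> measure (\<mu> \<bind> iterate \<pi> n) (ball z \<epsilon>)) sequentially"
proof -
  obtain \<alpha> :: real where \<alpha>: "\<alpha> > 0" "\<And>x. ennreal \<alpha> \<le> liminf (\<lambda>n. emeasure (iterate \<pi> n x) (ball z \<epsilon>))"
    using lower[OF \<epsilon>] by auto
  \<comment> \<open>Strictly below \<alpha>, to turn a bound on the liminf into one that holds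
    eventually; below 1, to leave a residual part of mass 1 - a.\<close>
  define a where "a = min (1/2) (\<alpha> / 2)"
  have a: "0 < a" "a < 1" "a < \<alpha>" using \<alpha>(1) by (auto simp: a_def min_def)
  show ?thesis
  proof (rule that[OF a(1,2)])
    fix \<mu> :: "'a measure" assume \<mu>: "\<mu> \<in> space (prob_algebra borel)"
    then have s[measurable_cong]: "sets \<mu> = sets borel" and "prob_space \<mu>"
      by (auto simp: space_prob_algebra)
    interpret prob_space \<mu> by fact
    note [measurable] = iterate_subprob[OF \<mu>]
    have em: "emeasure (\<mu> \<bind> iterate \<pi> n) (ball z \<epsilon>) = (\<integral>\<^sup>+x. emeasure (iterate \<pi> n x) (ball z \<epsilon>) \<partial>\<mu>)" for n
      by (rule emeasure_bind[OF not_empty iterate_subprob[OF \<mu>]]) simp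
    have m: "(\<lambda>x. emeasure (iterate \<pi> n x) (ball z \<epsilon>)) \<in> borel_measurable \<mu>" for n
      by (rule measurable_emeasure_kernel[OF iterate_subprob[OF \<mu>]]) simp
    have "ennreal a < ennreal \<alpha>" using a by (simp add: ennreal_less_iff)
    also have "\<dots> = (\<integral>\<^sup>+x. ennreal \<alpha> \<partial>\<mu>)" by (simp add: emeasure_space_1)
    also have "\<dots> \<le> (\<integral>\<^sup>+x. liminf (\<lambda>n. emeasure (iterate \<pi> n x) (ball z \<epsilon>)) \<partial>\<mu>)"
      by (intro nn_integral_mono \<alpha>)
    also have "\<dots> \<le> liminf (\<lambda>n. emeasure (\<mu> \<bind> iterate \<pi> n) (ball z \<epsilon>))"
      unfolding em by (rule nn_integral_liminf[OF m])
    finally have "eventually (\<lambda>n. ennreal a < emeasure (\<mu> \<bind> iterate \<pi> n) (ball z \<epsilon>)) sequentially"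
      by (rule less_LiminfD)
    then show "eventually (\<lambda>n. a \<le> measure (\<mu> \<bind> iterate \<pi> n) (ball z \<epsilon>)) sequentially"
    proof eventually_elim
      case (elim n)
      have "prob_space (\<mu> \<bind> iterate \<pi> n)"
        using bind_iterate_space[OF \<mu>, of n] by (simp add: space_prob_algebra)
      then show ?case using elim a
        by (simp add: finite_measure.emeasure_eq_measure[OF prob_space.finite_measure] ennreal_less_iff)
    qed
  qed
qed

text \<open>
  Coupling: both laws eventually put mass \<open>a\<close> near \<open>z\<close>, where the functions \<open>E \<phi> n\<close> are almost
  constant. Removing these parts contracts the remaining discrepancy by the factor \<open>1 - a\<close>.
\<close>
lemma merging:
  assumes \<phi>: "\<phi> \<in> bcontfun" and \<mu>: "\<mu> \<in> space (prob_algebra borel)" and \<nu>: "\<nu> \<in> space (prob_algebra borel)"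
  shows "(\<lambda>n. (\<integral>x. E \<phi> n x \<partial>\<mu>) - (\<integral>x. E \<phi> n x \<partial>\<nu>)) \<longlonglongrightarrow> 0"
proof (rule LIMSEQ_I)
  fix r :: real assume r: "0 < r"
  define \<delta> where "\<delta> = r / 4"
  have \<delta>: "0 < \<delta>" using r by (simp add: \<delta>_def)
  obtain \<epsilon> where \<epsilon>: "0 < \<epsilon>" "\<And>y n. dist y z < \<epsilon> \<Longrightarrow> \<bar>E \<phi> n y - E \<phi> n z\<bar> < \<delta>"
    using equicont_dist[OF \<phi> \<delta>] by metis
  obtain a where a: "0 < a" "a < 1"
    and mass: "\<And>\<mu>. \<mu> \<in> space (prob_algebra borel) \<Longrightarrow>
      eventually (\<lambda>n. a \<le> measure (\<mu> \<bind> iterate \<pi> n) (ball z \<epsilon>)) sequentially"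
    using eventually_ball_mass[OF \<epsilon>(1)] by metis
  obtain C where C: "C > 0" "\<And>x. \<bar>\<phi> x\<bar> \<le> C" using bcontfun_bounded[OF \<phi>] by metis
  \<comment> \<open>The solution of \<open>D (Suc k) = 2 * a * \<delta> + (1 - a) * D k\<close> that
    starts above the trivial bound \<open>2 * C\<close>. Its limit \<open>2 * \<delta>\<close> is
    r/2.\<close>
  define D where "D k = 2 * \<delta> + (1 - a) ^ k * (2 * C)" for k :: nat
  have near: "\<And>y. y \<in> ball z \<epsilon> \<Longrightarrow> \<bar>E \<phi> n y - E \<phi> n z\<bar> \<le> \<delta>" for n
    using \<epsilon>(2)[of _ n] by (simp add: dist_commute less_imp_le)
  \<comment> \<open>The laws are generalised because the induction passes to residual laws. The ball
    and \<open>a\<close> are fixed beforehand, so the contraction factor is the same in each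
    round.\<close>
  have main: "eventually (\<lambda>n. \<bar>(\<integral>x. E \<phi> n x \<partial>\<mu>) - (\<integral>x. E \<phi> n x \<partial>\<nu>)\<bar> \<le> D k) sequentially"
    if "\<mu> \<in> space (prob_algebra borel)" "\<nu> \<in> space (prob_algebra borel)" for \<mu> \<nu> k
    using that
  proof (induction k arbitrary: \<mu> \<nu>)
    case 0
    have b: "\<bar>\<integral>x. E \<phi> n x \<partial>\<mu>\<bar> \<le> C" if \<mu>: "\<mu> \<in> space (prob_algebra borel)" for \<mu> n
    proof -
      have "prob_space \<mu>" using \<mu> by (auto simp: space_prob_algebra)
      then interpret prob_space \<mu> .
      have "E \<phi> n x \<le> C" "- C \<le> E \<phi> n x" for x
        using E_abs_le[OF \<phi> C(2), of n x] by (auto simp: abs_le_iff minus_le_iff)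
      then have "(\<integral>x. E \<phi> n x \<partial>\<mu>) \<le> (\<integral>x. C \<partial>\<mu>)" "(\<integral>x. - C \<partial>\<mu>) \<le> (\<integral>x. E \<phi> n x \<partial>\<mu>)"
        by (intro integral_mono integrable_bcontfun[OF \<mu>] E_bcontfun[OF \<phi>] const_bcontfun; simp)+
      then show ?thesis by (simp add: prob_space abs_le_iff)
    qed
    show ?case
    proof (rule always_eventually, rule allI)
      fix n
      show "\<bar>(\<integral>x. E \<phi> n x \<partial>\<mu>) - (\<integral>x. E \<phi> n x \<partial>\<nu>)\<bar> \<le> D 0"
        using b[OF 0(1), of n] b[OF 0(2), of n] \<delta> by (simp add: D_def)
    qed
  next
    case (Suc k)
    obtain N where N: "a \<le> measure (\<mu> \<bind> iterate \<pi> N) (ball z \<epsilon>)" "a \<le> measure (\<nu> \<bind> iterate \<pi> N) (ball z \<epsilon>)"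
      using eventually_happens'[OF _ eventually_conj[OF mass[OF Suc(2)] mass[OF Suc(3)]]] by auto
    obtain \<mu>' where \<mu>': "\<mu>' \<in> space (prob_algebra borel)"
       "\<And>f c \<delta>. f \<in> bcontfun \<Longrightarrow> (\<And>y. y \<in> ball z \<epsilon> \<Longrightarrow> \<bar>f y - c\<bar> \<le> \<delta>) \<Longrightarrow>
       \<bar>(\<integral>x. f x \<partial>(\<mu> \<bind> iterate \<pi> N)) - (a * c + (1 - a) * (\<integral>x. f x \<partial>\<mu>'))\<bar> \<le> a * \<delta>"
      using residual_measure[OF bind_iterate_space[OF Suc(2)] _ a N(1)] by auto
    obtain \<nu>' where \<nu>': "\<nu>' \<in> space (prob_algebra borel)"
       "\<And>f c \<delta>. f \<in> bcontfun \<Longrightarrow> (\<And>y. y \<in> ball z \<epsilon> \<Longrightarrow> \<bar>f y - c\<bar> \<le> \<delta>) \<Longrightarrow>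
       \<bar>(\<integral>x. f x \<partial>(\<nu> \<bind> iterate \<pi> N)) - (a * c + (1 - a) * (\<integral>x. f x \<partial>\<nu>'))\<bar> \<le> a * \<delta>"
      using residual_measure[OF bind_iterate_space[OF Suc(3)] _ a N(2)] by auto
    have "eventually (\<lambda>n. \<bar>(\<integral>x. E \<phi> (n + N) x \<partial>\<mu>) - (\<integral>x. E \<phi> (n + N) x \<partial>\<nu>)\<bar> \<le> D (Suc k)) sequentially"
      using Suc.IH[OF \<mu>'(1) \<nu>'(1)]
    proof eventually_elim
      case (elim n)
      let ?p = "\<integral>x. E \<phi> n x \<partial>\<mu>'" and ?q = "\<integral>x. E \<phi> n x \<partial>\<nu>'"
      \<comment> \<open>Both laws share the term \<open>a * E \<phi> n z\<close>; it cancels in the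
        difference, at the price of \<open>2 * a * \<delta>\<close>.\<close>
      have 1: "\<bar>(\<integral>x. E \<phi> (n + N) x \<partial>\<mu>) - (a * E \<phi> n z + (1 - a) * ?p)\<bar> \<le> a * \<delta>"
        using \<mu>'(2)[OF E_bcontfun[OF \<phi>] near] integral_E_add[OF Suc(2) \<phi>, of N n] by (simp add: add.commute)
      have 2: "\<bar>(\<integral>x. E \<phi> (n + N) x \<partial>\<nu>) - (a * E \<phi> n z + (1 - a) * ?q)\<bar> \<le> a * \<delta>"
        using \<nu>'(2)[OF E_bcontfun[OF \<phi>] near] integral_E_add[OF Suc(3) \<phi>, of N n] by (simp add: add.commute)
      have "\<bar>(1 - a) * ?p - (1 - a) * ?q\<bar> = (1 - a) * \<bar>?p - ?q\<bar>"
        using a by (simp add: abs_mult flip: right_diff_distrib)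
      also have "\<dots> \<le> (1 - a) * D k" using elim a by (intro mult_left_mono) auto
      finally have 3: "\<bar>(1 - a) * ?p - (1 - a) * ?q\<bar> \<le> (1 - a) * D k" .
      have 4: "a * \<delta> + a * \<delta> + (1 - a) * D k = D (Suc k)"
        by (simp add: D_def algebra_simps)
      show ?case using 1 2 3 4 by linarith
    qed
    then show ?case by (rule eventually_sequentially_seg[THEN iffD1])
  qed
  have "(\<lambda>k. D k) \<longlonglongrightarrow> 2 * \<delta> + 0 * (2 * C)"
    unfolding D_def using a by (intro tendsto_intros LIMSEQ_power_zero) auto
  then have "eventually (\<lambda>k. D k < r) sequentially"
    by (rule order_tendstoD) (use r in \<open>simp add: \<delta>_def\<close>)
  then obtain k where "D k < r" by (auto simp: eventually_sequentially)
  have "eventually (\<lambda>n. norm ((\<integral>x. E \<phi> n x \<partial>\<mu>) - (\<integral>x. E \<phi> n x \<partial>\<nu>) - 0) < r) sequentially"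
    using main[OF \<mu> \<nu>, of k]
    by eventually_elim (use \<open>D k < r\<close> in simp)
  then show "\<exists>N. \<forall>n\<ge>N. norm ((\<integral>x. E \<phi> n x \<partial>\<mu>) - (\<integral>x. E \<phi> n x \<partial>\<nu>) - 0) < r"
    by (simp add: eventually_sequentially)
qed

lemma merging_point:
  assumes \<phi>: "\<phi> \<in> bcontfun" and \<mu>: "\<mu> \<in> space (prob_algebra borel)"
  shows "(\<lambda>n. (\<integral>x. E \<phi> n x \<partial>\<mu>) - E \<phi> n y) \<longlonglongrightarrow> 0"
  using merging[OF \<phi> \<mu> return_space[of y]]
  by (simp add: integral_return_borel bcontfun_measurable[OF E_bcontfun[OF \<phi>]])


section \<open>Uniform smoothness of the laws started at \<open>z\<close>\<close>

lemma E_tendsto_zero: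
  assumes F: "\<And>j. F j \<in> bcontfun" "\<And>j x. 0 \<le> F j x" "\<And>j x. F j x \<le> 1" "\<And>x. (\<lambda>j. F j x) \<longlonglongrightarrow> 0"
  shows "(\<lambda>j::nat. E (F j) n x) \<longlonglongrightarrow> 0"
proof -
  interpret prob_space "iterate \<pi> n x" by (rule prob_space_iterate)
  have m: "F j \<in> borel_measurable (iterate \<pi> n x)" for j
    using bcontfun_measurable[OF F(1)] measurable_cong_sets[OF sets_iterate refl] by blast
  have "(\<lambda>j. E (F j) n x) \<longlonglongrightarrow> (\<integral>y. 0 \<partial>iterate \<pi> n x)"
    unfolding E_def
    by (rule integral_dominated_convergence[where w="\<lambda>_. 1"]) (use F m in \<open>auto\<close>)
  then show ?thesis by simp
qed

text \<open>
  As the chain returns to the ball with probability at least \<open>\<alpha>\<close> at all late times, every good block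
  carries mass at least \<open>\<alpha> \<theta>\<close> at all late times; enough blocks exceed the total mass.
\<close>
lemma uniform_block_mass_impossible:
  fixes F :: "nat \<Rightarrow> 'a \<Rightarrow> real"
  assumes F: "\<And>j. F j \<in> bcontfun" "\<And>j x. 0 \<le> F j x" "\<And>j x. F j x \<le> 1"
    and dec: "\<And>i j x. i \<le> j \<Longrightarrow> F j x \<le> F i x"
    and r: "0 < r" and \<theta>: "0 < \<theta>"
    and good: "\<And>J. \<exists>j\<ge>J. \<exists>j'>j. \<exists>n. \<forall>y\<in>ball z r. \<theta> \<le> E (F j) n y - E (F j') n y"
  shows False
proof -
  obtain \<alpha> where \<alpha>: "0 < \<alpha>"
    and mass: "\<And>\<mu>. \<mu> \<in> space (prob_algebra borel) \<Longrightarrow>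
      eventually (\<lambda>n. \<alpha> \<le> measure (\<mu> \<bind> iterate \<pi> n) (ball z r)) sequentially"
    using eventually_ball_mass[OF r] by metis
  have "return borel z \<bind> iterate \<pi> n = iterate \<pi> n z" for n
    using iterate_add[of 0 n z] by simp
  then obtain N1 where N1: "\<And>n. N1 \<le> n \<Longrightarrow> \<alpha> \<le> measure (iterate \<pi> n z) (ball z r)"
    using mass[OF return_space[of z]] by (auto simp: eventually_sequentially)
  have Emono: "i \<le> j \<Longrightarrow> E (F j) n x \<le> E (F i) n x" for i j n x
    by (intro E_mono F dec)
  \<comment> \<open>Splitting off the last n0 steps, \<open>E (F j) n z\<close> averages
    \<open>E (F j) n0\<close> over the law at time n - n0. That law gives the ball mass at least
    \<alpha> once n - n0 reaches N1, and outside the ball the block is nonnegative.\<close>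
  have block: "\<alpha> * \<theta> \<le> E (F j) n z - E (F j') n z"
    if j: "j < j'" and n0: "\<forall>y\<in>ball z r. \<theta> \<le> E (F j) n0 y - E (F j') n0 y" and n: "n0 + N1 \<le> n" for j j' n0 n
  proof -
    define m where "m = n - n0"
    interpret prob_space "iterate \<pi> m z" by (rule prob_space_iterate)
    have nm: "n = m + n0" and m: "N1 \<le> m" using n by (auto simp: m_def)
    have "\<alpha> * \<theta> \<le> \<theta> * measure (iterate \<pi> m z) (ball z r)"
      using N1[OF m] \<theta> by simp
    also have "\<dots> = (\<integral>y. \<theta> * indicator (ball z r) y \<partial>iterate \<pi> m z)"
      using sets_eq_imp_space_eq[OF sets_iterate, of m z] by simp
    also have "\<dots> \<le> (\<integral>y. E (F j) n0 y - E (F j') n0 y \<partial>iterate \<pi> m z)"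
    proof (rule integral_mono)
      show "integrable (iterate \<pi> m z) (\<lambda>y. \<theta> * indicator (ball z r) y)"
        by (intro integrable_mult_right integrable_real_indicator)
           (simp_all add: sets_iterate less_top[symmetric])
      show "integrable (iterate \<pi> m z) (\<lambda>y. E (F j) n0 y - E (F j') n0 y)"
        by (intro integrable_iterate minus_cont E_bcontfun F)
      show "\<theta> * indicator (ball z r) y \<le> E (F j) n0 y - E (F j') n0 y" for y
        using n0 Emono[OF less_imp_le[OF j], of n0 y] by (cases "y \<in> ball z r") auto
    qed
    also have "\<dots> = E (E (F j) n0) m z - E (E (F j') n0) m z"
      unfolding E_def[of "E _ _"] by (intro Bochner_Integration.integral_diff integrable_iterate E_bcontfun F)
    also have "\<dots> = E (F j) n z - E (F j') n z"
      by (simp add: E_E[OF F(1)] nm)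
    finally show ?thesis .
  qed
  \<comment> \<open>Blocks from successive index ranges telescope within \<open>F 0 - F m\<close>.
    Each is charged at all late times, hence all of them at one common time.\<close>
  have "\<exists>m N. \<forall>n\<ge>N. real M * (\<alpha> * \<theta>) \<le> E (F 0) n z - E (F m) n z" for M
  proof (induction M)
    case 0
    show ?case using Emono[of 0 0] by (auto intro!: exI[of _ 0])
  next
    case (Suc M)
    then obtain m N where IH: "\<And>n. N \<le> n \<Longrightarrow> real M * (\<alpha> * \<theta>) \<le> E (F 0) n z - E (F m) n z" by auto
    obtain j j' n0 where j: "m \<le> j" "j < j'" "\<forall>y\<in>ball z r. \<theta> \<le> E (F j) n0 y - E (F j') n0 y"
      using good[of m] by auto
    have "real (Suc M) * (\<alpha> * \<theta>) \<le> E (F 0) n z - E (F j') n z" if "max N (n0 + N1) \<le> n" for n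
      using IH[of n] block[OF j(2,3), of n] Emono[OF j(1), of n z] that by (simp add: algebra_simps)
    then show ?case by blast
  qed
  moreover obtain M :: nat where "1 / (\<alpha> * \<theta>) < real M" using reals_Archimedean2 by blast
  then have "1 < real M * (\<alpha> * \<theta>)" using \<alpha> \<theta> by (simp add: field_simps)
  ultimately obtain m n where "1 < E (F 0) n z - E (F m) n z" by (meson less_le_trans order_refl)
  moreover have "E (F 0) n z \<le> E (\<lambda>x. 1) n z" by (intro E_mono F const_bcontfun)
  moreover have "0 \<le> E (F m) n z" by (intro E_nonneg F)
  ultimately show False by (simp add: E_const)
qed

text \<open>
  If this failed, there would be blocks \<open>F j - F j'\<close>, arbitrarily far out and not overlapping, each
  charged by some \<open>\<pi>\<^sup>n(z, \<cdot>)\<close>. Either infinitely many of them are charged uniformly from a whole ball around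
  \<open>z\<close>, which \<open>uniform_block_mass_impossible\<close> excludes, or one can choose starting points
  \<open>y \<rightarrow> z\<close> that charge the blocks much less than \<open>z\<close> does; then the sum \<open>f\<close> of the blocks violates
  equicontinuity at \<open>z\<close>. Continuity of \<open>f\<close> is automatic: the remainder after \<open>k\<close> blocks is at most
  \<open>F (m k)\<close>.
\<close>
lemma uniform_smooth:
  assumes F: "\<And>j. F j \<in> bcontfun" "\<And>j x. 0 \<le> F j x" "\<And>j x. F j x \<le> 1"
    and Suc_le: "\<And>j x. F (Suc j) x \<le> F j x" and lim: "\<And>x. (\<lambda>j. F j x) \<longlonglongrightarrow> 0"
    and \<theta>: "0 < \<theta>"
  shows "\<exists>j. \<forall>n. E (F j) n z \<le> \<theta>"
proof (rule ccontr)
  assume "\<not> (\<exists>j. \<forall>n. E (F j) n z \<le> \<theta>)"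
  then have large: "\<exists>n. \<theta> < E (F j) n z" for j by (auto simp: not_le)
  have dec: "F j x \<le> F i x" if "i \<le> j" for i j x
    using lift_Suc_antimono_le[of "\<lambda>j. F j x", OF Suc_le that] .
  have tail: "\<exists>m\<ge>J. E (F m) n x < e" if "0 < e" for J n x e
  proof -
    have "eventually (\<lambda>m. E (F m) n x < e \<and> J \<le> m) sequentially"
      using order_tendstoD(2)[OF E_tendsto_zero[OF F lim] that, of n x] eventually_ge_at_top[of J]
      by eventually_elim simp
    then show ?thesis by (auto simp: eventually_sequentially)
  qed
  \<comment> \<open>For each radius, every sufficiently late block is, at every time, charged by
    less than \<open>\<theta> / 4\<close> from some point of the ball.\<close>
  have bad: "\<exists>J. \<forall>j\<ge>J. \<forall>j'>j. \<forall>n. \<exists>y\<in>ball z r. E (F j) n y - E (F j') n y < \<theta> / 4" if "0 < r" for r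
  proof (rule ccontr)
    assume *: "\<not> ?thesis"
    show False
    proof (rule uniform_block_mass_impossible[OF F dec that, where \<theta>="\<theta> / 4"])
      show "0 < \<theta> / 4" using \<theta> by simp
      show "\<exists>j\<ge>J. \<exists>j'>j. \<exists>n. \<forall>y\<in>ball z r. \<theta> / 4 \<le> E (F j) n y - E (F j') n y" for J
        using * unfolding not_le[symmetric] by blast
    qed
  qed
  \<comment> \<open>A state records the sum G of the blocks so far, an index m beyond all of them,
    and the point and time chosen last. The bound by \<open>F 0 - F m\<close> leaves room for the
    blocks to come.\<close>
  define P where "P = (\<lambda>(k::nat) (G :: 'a \<Rightarrow> real, m :: nat, y :: 'a, n :: nat).
    G \<in> bcontfun \<and> (\<forall>x. 0 \<le> G x \<and> G x \<le> F 0 x - F m x))"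
  \<comment> \<open>The budget: the new block weighs more than \<open>\<theta> / 2\<close> at z and
    less than \<open>\<theta> / 4\<close> at y'; earlier blocks favour y' by less than
    \<open>\<theta> / 16\<close>, and later ones add less than \<open>\<theta> / 16\<close> there.
    The surplus at z exceeds \<open>\<theta> / 8\<close>, while equicontinuity of the full sum
    allows only \<open>\<theta> / 16\<close>.\<close>
  define Q where "Q = (\<lambda>(k::nat) (G :: 'a \<Rightarrow> real, m :: nat, y :: 'a, n :: nat) (G', m', y', n').
    \<exists>j j'. m \<le> j \<and> j < j' \<and> j' \<le> m' \<and> G' = (\<lambda>x. G x + (F j x - F j' x)) \<and> dist y' z < 1 / Suc k \<and>
      E G n' y' - E G n' z < \<theta> / 16 \<and> \<theta> < E (F j) n' z \<and> E (F j') n' z < \<theta> / 2 \<and>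
      E (F j) n' y' - E (F j') n' y' < \<theta> / 4 \<and> E (F m') n' y' < \<theta> / 16)"
  have "\<exists>s. \<forall>k. P k (s k) \<and> Q k (s k) (s (Suc k))"
  proof (rule dependent_nat_choice)
    show "\<exists>s. P 0 s"
      by (rule exI[of _ "(\<lambda>_. 0, 0, z, 0)"]) (simp add: P_def const_bcontfun)
    fix s k assume "P k s"
    then obtain G m y n where s: "s = (G, m, y, n)" and G: "G \<in> bcontfun"
      and Gb: "\<And>x. 0 \<le> G x" "\<And>x. G x \<le> F 0 x - F m x"
      by (cases s) (auto simp: P_def)
    \<comment> \<open>G is itself a test function, so the earlier blocks weigh almost the same from
      all points near z at all times; the time n' may thus be chosen afterwards.\<close>
    obtain d where d: "0 < d" "\<And>y n. dist y z < d \<Longrightarrow> \<bar>E G n y - E G n z\<bar> < \<theta> / 16"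
      using equicont_dist[OF G, of "\<theta> / 16" z] \<theta> by auto
    define r where "r = min d (1 / Suc k)"
    have r: "0 < r" using d by (simp add: r_def)
    obtain J where J: "\<And>j j' n. J \<le> j \<Longrightarrow> j < j' \<Longrightarrow> \<exists>y\<in>ball z r. E (F j) n y - E (F j') n y < \<theta> / 4"
      using bad[OF r] by blast
    define j where "j = max J m"
    obtain n' where n': "\<theta> < E (F j) n' z" using large by blast
    obtain j' where j': "Suc j \<le> j'" "E (F j') n' z < \<theta> / 2"
      using tail[of "\<theta> / 2" "Suc j" n' z] \<theta> by auto
    have "J \<le> j" "j < j'" using j' by (auto simp: j_def)
    from J[OF this, of n'] obtain y' where y': "dist y' z < r" "E (F j) n' y' - E (F j') n' y' < \<theta> / 4"
      by (auto simp: dist_commute)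
    \<comment> \<open>Chosen last, for this y' and n', so that all later blocks together are
      negligible there. At z later blocks can only add mass.\<close>
    obtain m' where m': "j' \<le> m'" "E (F m') n' y' < \<theta> / 16"
      using tail[of "\<theta> / 16" j' n' y'] \<theta> by auto
    define G' where "G' x = G x + (F j x - F j' x)" for x
    have "P (Suc k) (G', m', y', n')"
    proof -
      have "0 \<le> G' x" "G' x \<le> F 0 x - F m' x" for x
        using Gb[of x] dec[OF less_imp_le[OF \<open>j < j'\<close>], of x] dec[of m j x] dec[OF m'(1), of x]
        by (auto simp: G'_def j_def)
      moreover have "G' \<in> bcontfun" unfolding G'_def by (intro plus_cont minus_cont G F)
      ultimately show ?thesis by (simp add: P_def)
    qed
    moreover have Gd: "E G n' y' - E G n' z < \<theta> / 16"
      using d(2)[of y' n'] y'(1) unfolding r_def abs_less_iff by simp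
    have "Q k s (G', m', y', n')"
      unfolding Q_def s prod.case
      by (rule exI[of _ j], rule exI[of _ j'])
         (use Gd y' j' m' n' in \<open>auto simp: G'_def r_def j_def\<close>)
    ultimately show "\<exists>s'. P (Suc k) s' \<and> Q k s s'" by blast
  qed
  then obtain s where s: "\<And>k. P k (s k)" "\<And>k. Q k (s k) (s (Suc k))" by auto
  define G m y n where "G k = fst (s k)" and "m k = fst (snd (s k))"
    and "y k = fst (snd (snd (s k)))" and "n k = snd (snd (snd (s k)))" for k
  have sk: "s k = (G k, m k, y k, n k)" for k by (simp add: G_def m_def y_def n_def)
  have G: "G k \<in> bcontfun" and Gb: "0 \<le> G k x" "G k x \<le> F 0 x - F (m k) x" for k x
    using s(1)[of k] by (auto simp: P_def sk)
  define R where "R k j j' \<longleftrightarrow> m k \<le> j \<and> j < j' \<and> j' \<le> m (Suc k) \<and> G (Suc k) = (\<lambda>x. G k x + (F j x - F j' x)) \<and>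
      dist (y (Suc k)) z < 1 / Suc k \<and>
      E (G k) (n (Suc k)) (y (Suc k)) - E (G k) (n (Suc k)) z < \<theta> / 16 \<and>
      \<theta> < E (F j) (n (Suc k)) z \<and> E (F j') (n (Suc k)) z < \<theta> / 2 \<and>
      E (F j) (n (Suc k)) (y (Suc k)) - E (F j') (n (Suc k)) (y (Suc k)) < \<theta> / 4 \<and>
      E (F (m (Suc k))) (n (Suc k)) (y (Suc k)) < \<theta> / 16" for k j j'
  have "\<exists>j j'. R k j j'" for k
    using s(2)[of k] unfolding Q_def R_def sk prod.case .
  then obtain a b where R: "\<And>k. R k (a k) (b k)" by metis
  have ab: "\<And>k. m k \<le> a k" "\<And>k. a k < b k" "\<And>k. b k \<le> m (Suc k)"
    and GS: "\<And>k. G (Suc k) = (\<lambda>x. G k x + (F (a k) x - F (b k) x))"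
    and yz: "\<And>k. dist (y (Suc k)) z < 1 / Suc k"
    and Ey: "\<And>k. E (G k) (n (Suc k)) (y (Suc k)) - E (G k) (n (Suc k)) z < \<theta> / 16"
    and Ea: "\<And>k. \<theta> < E (F (a k)) (n (Suc k)) z" and Eb: "\<And>k. E (F (b k)) (n (Suc k)) z < \<theta> / 2"
    and Eab: "\<And>k. E (F (a k)) (n (Suc k)) (y (Suc k)) - E (F (b k)) (n (Suc k)) (y (Suc k)) < \<theta> / 4"
    and Em: "\<And>k. E (F (m (Suc k))) (n (Suc k)) (y (Suc k)) < \<theta> / 16"
    using R unfolding R_def by blast+
  have "m k < m (Suc k)" for k using ab[of k] by linarith
  then have m: "strict_mono m" by (simp add: strict_mono_Suc_iff)
  have GS_le: "G (Suc k) x \<le> G k x + F (m k) x - F (m (Suc k)) x" "G k x \<le> G (Suc k) x" for k x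
    using dec[OF ab(1)[of k], of x] dec[OF ab(3)[of k], of x] dec[OF less_imp_le[OF ab(2)[of k]], of x]
    by (auto simp: GS)
  have Gmono: "G k x \<le> G l x" if "k \<le> l" for k l x
    using lift_Suc_mono_le[of "\<lambda>k. G k x", OF GS_le(2) that] .
  have "G l x + F (m l) x \<le> G k x + F (m k) x" if "k \<le> l" for k l x
    by (rule lift_Suc_antimono_le[of "\<lambda>k. G k x + F (m k) x", OF _ that]) (use GS_le(1) in smt)
  then have Gle: "G l x \<le> G k x + F (m k) x" for k l x
    using F(2)[of "m l" x] F(2)[of "m k" x] Gmono[of l k x] by (cases "k \<le> l") (smt (verit) nat_le_linear)+
  define f where "f x = (SUP k. G k x)" for x
  have bdd: "bdd_above (range (\<lambda>k. G k x))" for x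
    using Gle[of _ x 0] by (auto simp: bdd_above_def)
  have lef: "G k x \<le> f x" for k x
    unfolding f_def by (rule cSUP_upper[OF UNIV_I bdd])
  have fle: "f x \<le> G k x + F (m k) x" for k x
    unfolding f_def by (rule cSUP_least) (auto intro: Gle)
  have "continuous_on UNIV f"
    unfolding continuous_on_iff
  proof (intro ballI allI impI)
    fix x and e :: real assume e: "0 < e"
    have "(\<lambda>k. F (m k) x) \<longlonglongrightarrow> 0"
      using LIMSEQ_subseq_LIMSEQ[OF lim m] by (simp add: o_def)
    then have "eventually (\<lambda>k. F (m k) x < e / 4) sequentially"
      by (rule order_tendstoD) (use e in simp)
    \<comment> \<open>The gap \<open>F (m k)\<close> is continuous and small at x, hence small near
      x: convergence of the partial sums is locally uniform, as in Dini's theorem.\<close>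
    then obtain k where k: "F (m k) x < e / 4" by (auto simp: eventually_sequentially)
    obtain d1 where d1: "0 < d1" "\<And>y. dist y x < d1 \<Longrightarrow> \<bar>G k y - G k x\<bar> < e / 4"
      using bcontfun_continuous[OF G[of k]] e unfolding continuous_on_iff dist_real_def
      by (metis UNIV_I zero_less_divide_iff zero_less_numeral)
    obtain d2 where d2: "0 < d2" "\<And>y. dist y x < d2 \<Longrightarrow> \<bar>F (m k) y - F (m k) x\<bar> < e / 4"
      using bcontfun_continuous[OF F(1)[of "m k"]] e unfolding continuous_on_iff dist_real_def
      by (metis UNIV_I zero_less_divide_iff zero_less_numeral)
    have "dist (f y) (f x) < e" if "dist y x < min d1 d2" for y
    proof -
      have "\<bar>G k y - G k x\<bar> < e / 4" "\<bar>F (m k) y - F (m k) x\<bar> < e / 4"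
        using d1(2)[of y] d2(2)[of y] that by auto
      with k lef[of k x] lef[of k y] fle[of x k] fle[of y k] F(2)[of "m k" x] F(2)[of "m k" y]
      show ?thesis unfolding dist_real_def by linarith
    qed
    then show "\<exists>d>0. \<forall>y\<in>UNIV. dist y x < d \<longrightarrow> dist (f y) (f x) < e"
      using d1 d2 by (intro exI[of _ "min d1 d2"]) simp
  qed
  moreover have "0 \<le> f x" "f x \<le> 2" for x
    using lef[of 0 x] fle[of x 0] Gb[of 0 x] F(3)[of 0 x] F(3)[of "m 0" x] F(2)[of "m 0" x] by linarith+
  ultimately have f: "f \<in> bcontfun" by (intro bcontfunI_bounds)
  obtain d where d: "0 < d" "\<And>y n. dist y z < d \<Longrightarrow> \<bar>E f n y - E f n z\<bar> < \<theta> / 16"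
    using equicont_dist[OF f, of "\<theta> / 16" z] \<theta> by auto
  obtain k where k: "1 / Suc k < d"
    using d(1) nat_approx_posE by blast
  let ?n = "n (Suc k)" and ?y = "y (Suc k)"
  have EGS: "E (G (Suc k)) ?n x = E (G k) ?n x + (E (F (a k)) ?n x - E (F (b k)) ?n x)" for x
    unfolding GS by (simp add: E_plus E_minus minus_cont G F)
  have "E (G (Suc k)) ?n z \<le> E f ?n z"
    by (intro E_mono G f lef)
  moreover have "E f ?n ?y \<le> E (G (Suc k)) ?n ?y + E (F (m (Suc k))) ?n ?y"
    unfolding E_plus[OF G F(1), symmetric] by (intro E_mono f plus_cont G F fle)
  moreover have "\<bar>E f ?n ?y - E f ?n z\<bar> < \<theta> / 16"
    using yz[of k] k by (intro d(2)) linarith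
  ultimately show False
    using EGS[of z] EGS[of ?y] Ey[of k] Ea[of k] Eb[of k] Eab[of k] Em[of k] \<theta> by linarith
qed


text \<open>
  The functions \<open>F j = sup {\<bar>E \<phi> k - E \<phi> k z\<bar> | k \<ge> j} / (2 C)\<close> are continuous by equicontinuity and
  decrease to \<open>0\<close> by coupling, so \<open>uniform_smooth\<close> bounds their means under all \<open>\<pi>\<^sup>n(z, \<cdot>)\<close>
  simultaneously.
\<close>
lemma E_convergent:
  assumes \<phi>: "\<phi> \<in> bcontfun"
  shows "convergent (\<lambda>n. E \<phi> n z)"
proof -
  obtain C where C: "C > 0" "\<And>x. \<bar>\<phi> x\<bar> \<le> C" using bcontfun_bounded[OF \<phi>] by metis
  define F where "F j x = (SUP k\<in>{j..}. \<bar>E \<phi> k x - E \<phi> k z\<bar> / (2 * C))" for j x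
  have le1: "\<bar>E \<phi> k x - E \<phi> k z\<bar> / (2 * C) \<le> 1" for k x
    using E_abs_le[OF \<phi> C(2), of k x] E_abs_le[OF \<phi> C(2), of k z] C(1) by (simp add: field_simps)
  have bdd: "bdd_above ((\<lambda>k. \<bar>E \<phi> k x - E \<phi> k z\<bar> / (2 * C)) ` {j..})" for j x
    using le1 by (auto simp: bdd_above_def)
  have upper: "\<bar>E \<phi> k x - E \<phi> k z\<bar> / (2 * C) \<le> F j x" if "j \<le> k" for j k x
    unfolding F_def using that by (intro cSUP_upper bdd) auto
  have least: "F j x \<le> b" if "\<And>k. j \<le> k \<Longrightarrow> \<bar>E \<phi> k x - E \<phi> k z\<bar> / (2 * C) \<le> b" for j x b
    unfolding F_def using that by (intro cSUP_least) auto
  have F0: "0 \<le> F j x" for j x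
    by (rule order_trans[OF _ upper[OF order_refl]]) (use C(1) in simp)
  have F1: "F j x \<le> 1" for j x by (intro least le1)
  have FS: "F (Suc j) x \<le> F j x" for j x by (intro least upper) simp
  have lim: "(\<lambda>j. F j x) \<longlonglongrightarrow> 0" for x
  proof (rule LIMSEQ_I)
    fix r :: real assume r: "0 < r"
    have "(\<lambda>n. E \<phi> n x - E \<phi> n z) \<longlonglongrightarrow> 0"
      using merging_point[OF \<phi> return_space[of x], of z]
      by (simp add: integral_return_borel bcontfun_measurable[OF E_bcontfun[OF \<phi>]])
    from LIMSEQ_D[OF this, of "r * C"] r C(1) obtain N where
      N: "\<And>n. N \<le> n \<Longrightarrow> \<bar>E \<phi> n x - E \<phi> n z\<bar> < r * C" by auto
    have "norm (F j x - 0) < r" if "N \<le> j" for j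
    proof -
      have "F j x \<le> r / 2"
        using N that C(1) by (intro least) (simp add: field_simps less_imp_le)
      then show ?thesis using F0[of j x] r by simp
    qed
    then show "\<exists>N. \<forall>j\<ge>N. norm (F j x - 0) < r" by blast
  qed
  have cont: "F j \<in> bcontfun" for j
  proof (rule bcontfunI_bounds[OF _ F0 F1])
    show "continuous_on UNIV (F j)"
      unfolding continuous_on_iff
    proof (intro ballI allI impI)
      fix x and e :: real assume e: "0 < e"
      obtain d where d: "0 < d" "\<And>y n. dist y x < d \<Longrightarrow> \<bar>E \<phi> n y - E \<phi> n x\<bar> < e * C"
        using equicont_dist[OF \<phi>, of "e * C" x] e C(1) by auto
      \<comment> \<open>A supremum inherits the common modulus of its family; division by
        \<open>2 * C\<close> turns \<open>e * C\<close> into \<open>e / 2\<close>.\<close>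
      have *: "F j u \<le> F j v + e / 2" if "\<And>n. \<bar>E \<phi> n u - E \<phi> n v\<bar> < e * C" for u v
      proof (rule least)
        fix k assume k: "j \<le> k"
        have "\<bar>E \<phi> k u - E \<phi> k z\<bar> \<le> \<bar>E \<phi> k v - E \<phi> k z\<bar> + e * C"
          using that[of k] by linarith
        then have "\<bar>E \<phi> k u - E \<phi> k z\<bar> / (2 * C) \<le> \<bar>E \<phi> k v - E \<phi> k z\<bar> / (2 * C) + e / 2"
          using C(1) by (simp add: field_simps)
        also have "\<dots> \<le> F j v + e / 2" using upper[OF k] by simp
        finally show "\<bar>E \<phi> k u - E \<phi> k z\<bar> / (2 * C) \<le> F j v + e / 2" .
      qed
      have "dist (F j y) (F j x) < e" if "dist y x < d" for y
        using *[of y x] *[of x y] d(2)[OF that] e by (simp add: dist_real_def abs_minus_commute abs_less_iff)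
      then show "\<exists>d>0. \<forall>y\<in>UNIV. dist y x < d \<longrightarrow> dist (F j y) (F j x) < e" using d(1) by blast
    qed
  qed
  have "Cauchy (\<lambda>n. E \<phi> n z)"
    unfolding Cauchy_altdef2
  proof (intro allI impI)
    fix e :: real assume e: "0 < e"
    obtain j where j: "\<And>n. E (F j) n z \<le> e / (4 * C)"
      using uniform_smooth[OF cont F0 F1 FS lim, of "e / (4 * C)"] e C(1) by auto
    have "dist (E \<phi> n z) (E \<phi> j z) < e" if "j \<le> n" for n
    proof -
      \<comment> \<open>The increment from time j to time n is the mean of
        \<open>E \<phi> j - E \<phi> j z\<close> under the law at time m. As j is fixed and m
        arbitrary, the bound on the mean of \<open>F j\<close> has to be uniform in time.\<close>
      define m where "m = n - j"
      have n: "n = m + j" using that by (simp add: m_def)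
      have bc: "(\<lambda>y. E \<phi> j y - E \<phi> j z) \<in> bcontfun" "(\<lambda>y. 2 * C * F j y) \<in> bcontfun"
        by (intro minus_cont E_bcontfun \<phi> const_bcontfun mult_cont cont)+
      have "E \<phi> n z - E \<phi> j z = E (\<lambda>y. E \<phi> j y - E \<phi> j z) m z"
        using E_minus[OF E_bcontfun[OF \<phi>, of j] const_bcontfun[of "E \<phi> j z"], of m z]
        by (simp add: E_E[OF \<phi>] n E_const)
      moreover have abs_le: "\<bar>E \<phi> j y - E \<phi> j z\<bar> \<le> 2 * C * F j y" for y
        using upper[of j j y] C(1) by (simp add: field_simps)
      have b: "E \<phi> j y - E \<phi> j z \<le> 2 * C * F j y" "- (2 * C * F j y) \<le> E \<phi> j y - E \<phi> j z" for y
        using abs_le[of y] by linarith+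
      have "E (\<lambda>y. E \<phi> j y - E \<phi> j z) m z \<le> E (\<lambda>y. 2 * C * F j y) m z"
        by (intro E_mono bc b)
      moreover have "E (\<lambda>y. - (2 * C * F j y)) m z \<le> E (\<lambda>y. E \<phi> j y - E \<phi> j z) m z"
        by (intro E_mono bc b uminus_cont)
      moreover have "E (\<lambda>y. - (2 * C * F j y)) m z = - E (\<lambda>y. 2 * C * F j y) m z"
        using E_mult[of "-1" "\<lambda>y. 2 * C * F j y" m z] by simp
      moreover have "E (\<lambda>y. 2 * C * F j y) m z \<le> e / 2"
        using j[of m] C(1) by (simp only: E_mult) (simp add: field_simps)
      ultimately show ?thesis using e unfolding dist_real_def by linarith
    qed
    then show "\<exists>N. \<forall>n\<ge>N. dist (E \<phi> n z) (E \<phi> N z) < e" by blast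
  qed
  then show ?thesis by (rule Cauchy_convergent)
qed

section \<open>The limit functional\<close>

text \<open>Read off at z, where convergence has been shown; by merging, every initial law yields
  the same value.\<close>

definition limE :: "('a \<Rightarrow> real) \<Rightarrow> real" where
  "limE \<phi> = lim (\<lambda>n. E \<phi> n z)"

lemma limE_z: "\<phi> \<in> bcontfun \<Longrightarrow> (\<lambda>n. E \<phi> n z) \<longlonglongrightarrow> limE \<phi>"
  unfolding limE_def using E_convergent convergent_LIMSEQ_iff by blast

lemma limE_measure:
  assumes \<phi>: "\<phi> \<in> bcontfun" and \<mu>: "\<mu> \<in> space (prob_algebra borel)"
  shows "(\<lambda>n. \<integral>x. E \<phi> n x \<partial>\<mu>) \<longlonglongrightarrow> limE \<phi>"
  using tendsto_add[OF merging_point[OF \<phi> \<mu>, of z] limE_z[OF \<phi>]] by simp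

lemma limE_point: "\<phi> \<in> bcontfun \<Longrightarrow> (\<lambda>n. E \<phi> n x) \<longlonglongrightarrow> limE \<phi>"
  using limE_measure[OF _ return_space[of x]]
  by (simp add: integral_return_borel bcontfun_measurable E_bcontfun)

text \<open>Finitely many balls cover K on which \<open>E \<phi> n\<close> varies by less than
  \<open>e / 2\<close> for all n at once, so convergence at their centres is enough.\<close>

lemma limE_compact:
  assumes \<phi>: "\<phi> \<in> bcontfun" and K: "compact K" and e: "0 < e"
  shows "eventually (\<lambda>n. \<forall>x\<in>K. \<bar>E \<phi> n x - limE \<phi>\<bar> \<le> e) sequentially"
proof -
  have "\<exists>d>0. \<forall>y n. dist y x < d \<longrightarrow> \<bar>E \<phi> n y - E \<phi> n x\<bar> < e / 2" for x
    using equicont_dist[OF \<phi>, of "e / 2" x] e by (metis half_gt_zero)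
  then obtain d where d: "\<And>x. 0 < d x" "\<And>x y n. dist y x < d x \<Longrightarrow> \<bar>E \<phi> n y - E \<phi> n x\<bar> < e / 2"
    by metis
  obtain S where S: "S \<subseteq> K" "finite S" "K \<subseteq> (\<Union>x\<in>S. ball x (d x))"
    by (rule compactE_image[OF K, of K "\<lambda>x. ball x (d x)"]) (use d(1) in auto)
  have "eventually (\<lambda>n. \<bar>E \<phi> n x - limE \<phi>\<bar> < e / 2) sequentially" for x
    using tendstoD[OF limE_point[OF \<phi>], of "e / 2" x] e by (simp add: dist_real_def)
  then have "eventually (\<lambda>n. \<forall>x\<in>S. \<bar>E \<phi> n x - limE \<phi>\<bar> < e / 2) sequentially"
    using S(2) by (intro eventually_ball_finite) auto
  then show ?thesis
  proof eventually_elim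
    case (elim n)
    show ?case
    proof
      fix y assume "y \<in> K"
      then obtain x where x: "x \<in> S" "dist y x < d x" using S(3) by (auto simp: dist_commute)
      show "\<bar>E \<phi> n y - limE \<phi>\<bar> \<le> e"
        using d(2)[OF x(2), of n] elim x(1) by (smt (verit) field_sum_of_halves)
    qed
  qed
qed

sublocale limE: sigma_smooth_functional limE
proof
  fix f g :: "'a \<Rightarrow> real" assume f: "f \<in> bcontfun"
  show "limE (\<lambda>x. f x + g x) = limE f + limE g" if g: "g \<in> bcontfun"
    using limE_z[OF plus_cont[OF f g]] tendsto_add[OF limE_z[OF f] limE_z[OF g]]
    by (simp add: E_plus f g LIMSEQ_unique)
  show "limE (\<lambda>x. c * f x) = c * limE f" for c
    using limE_z[OF mult_cont[OF f, of c]] tendsto_mult_left[OF limE_z[OF f], of c]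
    by (simp add: E_mult LIMSEQ_unique)
  show "0 \<le> limE f" if "\<And>x. 0 \<le> f x"
    by (intro LIMSEQ_le_const[OF limE_z[OF f]]) (blast intro: E_nonneg f that)
next
  show "limE (\<lambda>x. 1) = 1"
    using limE_z[OF const_bcontfun[of 1]] by (simp add: E_const LIMSEQ_const_iff)
next
  fix F :: "nat \<Rightarrow> 'a \<Rightarrow> real"
  assume F: "\<And>j. F j \<in> bcontfun" "\<And>j x. 0 \<le> F j x" "\<And>j x. F j x \<le> 1"
    "\<And>j x. F (Suc j) x \<le> F j x" "\<And>x. (\<lambda>j. F j x) \<longlonglongrightarrow> 0"
  show "(\<lambda>j. limE (F j)) \<longlonglongrightarrow> 0"
  proof (rule LIMSEQ_I)
    fix r :: real assume r: "0 < r"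
    \<comment> \<open>A bound uniform in n survives the passage to the limit in n; this is the
      interchange of the limits in n and j.\<close>
    obtain j0 where j0: "\<And>n. E (F j0) n z \<le> r / 2"
      using uniform_smooth[OF F, of "r / 2"] r by auto
    have "norm (limE (F j) - 0) < r" if j: "j0 \<le> j" for j
    proof -
      have "F j x \<le> F j0 x" for x
        using lift_Suc_antimono_le[of "\<lambda>j. F j x", OF F(4) j] .
      then have "E (F j) n z \<le> r / 2" for n
        by (intro order_trans[OF _ j0[of n]] E_mono F)
      then have "limE (F j) \<le> r / 2"
        by (intro LIMSEQ_le_const2[OF limE_z[OF F(1)]]) blast
      moreover have "0 \<le> limE (F j)"
        by (intro LIMSEQ_le_const[OF limE_z[OF F(1)]]) (blast intro: E_nonneg F)
      ultimately show ?thesis using r by simp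
    qed
    then show "\<exists>N. \<forall>j\<ge>N. norm (limE (F j) - 0) < r" by blast
  qed
qed

section \<open>Existence and uniqueness of the invariant measure\<close>

lemma invariant_prob_iff:
  "invariant_prob \<pi> \<mu> \<longleftrightarrow> \<mu> \<in> space (prob_algebra borel) \<and> \<mu> \<bind> iterate \<pi> 1 = \<mu>"
proof (cases "\<mu> \<in> space (prob_algebra borel)")
  case True
  have 1: "measure (\<mu> \<bind> iterate \<pi> 1) A = (\<integral>x. measure (\<pi> x) A \<partial>\<mu>)" if "A \<in> sets borel" for A
    using measure_bind_iterate[OF kernel True that, of 1] by (simp only: iterate_1[OF kernel])
  have "\<mu> \<bind> iterate \<pi> 1 = \<mu>" if *: "\<And>A. A \<in> sets borel \<Longrightarrow> measure (\<mu> \<bind> iterate \<pi> 1) A = measure \<mu> A"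
  proof (rule measure_eqI)
    have p: "sets (\<mu> \<bind> iterate \<pi> 1) = sets borel" "sets \<mu> = sets borel"
       "finite_measure (\<mu> \<bind> iterate \<pi> 1)" "finite_measure \<mu>"
      using bind_iterate_space[OF True, of 1] True
      by (auto simp: space_prob_algebra intro: prob_space.finite_measure)
    then show "sets (\<mu> \<bind> iterate \<pi> 1) = sets \<mu>" by simp
    fix A assume "A \<in> sets (\<mu> \<bind> iterate \<pi> 1)"
    then show "emeasure (\<mu> \<bind> iterate \<pi> 1) A = emeasure \<mu> A"
      using * p by (simp add: finite_measure.emeasure_eq_measure)
  qed
  then show ?thesis
    using True 1 by (auto simp: invariant_prob_def)
qed (simp add: invariant_prob_def)

text \<open>Under an invariant law the means of \<open>E \<phi> n\<close> do not depend on n, while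
  merging sends them to \<open>limE \<phi>\<close>. This gives uniqueness and identifies the limit
  in the final claims.\<close>

lemma integral_invariant:
  assumes \<nu>: "invariant_prob \<pi> \<nu>" and \<phi>: "\<phi> \<in> bcontfun"
  shows "(\<integral>x. \<phi> x \<partial>\<nu>) = limE \<phi>"
proof -
  have s: "\<nu> \<in> space (prob_algebra borel)" and i: "\<nu> \<bind> iterate \<pi> 1 = \<nu>"
    using \<nu> by (auto simp: invariant_prob_iff)
  have "(\<integral>x. E \<phi> n x \<partial>\<nu>) = (\<integral>x. \<phi> x \<partial>\<nu>)" for n
  proof (induction n)
    case 0
    show ?case by (simp add: E_0[OF \<phi>])
  next
    case (Suc n)
    then show ?case using integral_E_add[OF s \<phi>, of 1 n] i by simp
  qed
  then show ?thesis using limE_measure[OF \<phi> s] by (simp add: LIMSEQ_const_iff)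
qed

lemma ex1_invariant_prob: "\<exists>!\<mu>. invariant_prob \<pi> \<mu>"
proof -
  obtain \<mu> where \<mu>: "\<mu> \<in> space (prob_algebra borel)" "\<And>\<phi>. \<phi> \<in> bcontfun \<Longrightarrow> (\<integral>x. \<phi> x \<partial>\<mu>) = limE \<phi>"
    using limE.representation by metis
  have "\<mu> \<bind> iterate \<pi> 1 = \<mu>"
  proof (rule borel_prob_eqI_bcontfun[OF bind_iterate_space[OF \<mu>(1)] \<mu>(1)])
    fix \<phi> :: "'a \<Rightarrow> real" assume \<phi>: "\<phi> \<in> bcontfun"
    \<comment> \<open>Shifting time by one step leaves the limit unchanged; by the Feller property
      \<open>limE\<close> applies to \<open>E \<phi> 1\<close>.\<close>
    have "(\<lambda>n. E (E \<phi> 1) n z) \<longlonglongrightarrow> limE \<phi>"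
      using LIMSEQ_Suc[OF limE_z[OF \<phi>]] by (simp add: E_E[OF \<phi>])
    then have "limE (E \<phi> 1) = limE \<phi>"
      using limE_z[OF E_bcontfun[OF \<phi>]] LIMSEQ_unique by blast
    then show "(\<integral>x. \<phi> x \<partial>(\<mu> \<bind> iterate \<pi> 1)) = (\<integral>x. \<phi> x \<partial>\<mu>)"
      by (simp only: integral_bind_iterate[OF \<mu>(1) \<phi>] \<mu>(2) E_bcontfun \<phi>)
  qed
  then have "invariant_prob \<pi> \<mu>" using \<mu>(1) by (simp only: invariant_prob_iff)
  moreover have "\<nu> = \<nu>'" if "invariant_prob \<pi> \<nu>" "invariant_prob \<pi> \<nu>'" for \<nu> \<nu>'
    using that by (intro borel_prob_eqI_bcontfun) (auto simp: integral_invariant invariant_prob_def)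
  ultimately show ?thesis by blast
qed

text \<open>Averaging over K preserves closeness to c, so a bound for the points of K bounds all
  measures concentrated on K at once.\<close>

lemma concentrated_deviation:
  assumes \<phi>: "\<phi> \<in> bcontfun" and \<mu>: "\<mu> \<in> space (prob_algebra borel)"
    and K: "compact K" "measure \<mu> (UNIV - K) = 0"
    and e: "\<And>x. x \<in> K \<Longrightarrow> \<bar>E \<phi> n x - c\<bar> \<le> e"
  shows "\<bar>(\<integral>x. \<phi> x \<partial>(\<mu> \<bind> iterate \<pi> n)) - c\<bar> \<le> e"
proof -
  have s: "sets \<mu> = sets borel" and "prob_space \<mu>"
    using \<mu> by (auto simp: space_prob_algebra)
  interpret prob_space \<mu> by fact
  have "UNIV - K \<in> null_sets \<mu>"
    using K by (auto simp: null_sets_def emeasure_eq_measure s borel_compact compact_imp_closed)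
  then have "AE x in \<mu>. x \<notin> UNIV - K" by (rule AE_not_in)
  then have ae: "AE x in \<mu>. E \<phi> n x \<le> c + e" "AE x in \<mu>. c - e \<le> E \<phi> n x"
    by (eventually_elim, use e in \<open>force simp: abs_le_iff\<close>)+
  have "(\<integral>x. E \<phi> n x \<partial>\<mu>) \<le> (\<integral>x. c + e \<partial>\<mu>)" "(\<integral>x. c - e \<partial>\<mu>) \<le> (\<integral>x. E \<phi> n x \<partial>\<mu>)"
    by (intro integral_mono_AE integrable_bcontfun[OF \<mu>] E_bcontfun[OF \<phi>] const_bcontfun ae)+
  then show ?thesis by (simp add: integral_bind_iterate[OF \<mu> \<phi>] prob_space abs_le_iff)
qed

end

theorem theorem4p5:
  fixes \<pi> :: "'a::metric_space \<Rightarrow> 'a measure" and K :: "'a set" and z :: 'a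
  assumes "transition_function \<pi>"
    and "compact K"
    and "\<forall>\<epsilon>>0. \<exists>\<alpha>::real. \<alpha> > 0 \<and>
           (\<forall>x. liminf (\<lambda>n. emeasure (iterate \<pi> n x) (ball z \<epsilon>)) \<ge> ennreal \<alpha>)"
    and "\<forall>\<phi>\<in>bcontfun. \<forall>x.
           equicontinuous_at {n::nat. n \<ge> 1} (\<lambda>n x. \<integral>y. \<phi> y \<partial>iterate \<pi> n x) x"
  shows "(\<exists>!\<mu>. invariant_prob \<pi> \<mu>) \<and>
    (\<forall>\<nu>. invariant_prob \<pi> \<nu> \<longrightarrow>
      (\<forall>\<phi>\<in>bcontfun.
        (\<lambda>n. SUP \<mu>\<in>{\<mu> \<in> space (prob_algebra borel). measure \<mu> (UNIV - K) = 0}.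
           ennreal \<bar>(\<integral>y. \<phi> y \<partial>(\<mu> \<bind> iterate \<pi> n)) - (\<integral>y. \<phi> y \<partial>\<nu>)\<bar>) \<longlonglongrightarrow> 0) \<and>
      (\<forall>K'. compact K' \<longrightarrow> (\<forall>\<phi>\<in>bcontfun.
        (\<lambda>n. SUP x\<in>K'. ennreal \<bar>(\<integral>y. \<phi> y \<partial>iterate \<pi> n x) - (\<integral>y. \<phi> y \<partial>\<nu>)\<bar>) \<longlonglongrightarrow> 0)))"
proof -
  interpret equicontinuous_chain \<pi> z
    using assms(1,3,4) by unfold_locales auto
  show ?thesis
  proof (intro conjI allI impI ballI ex1_invariant_prob)
    fix \<nu> :: "'a measure" and \<phi> :: "'a \<Rightarrow> real"
    assume \<nu>: "invariant_prob \<pi> \<nu>" and \<phi>: "\<phi> \<in> bcontfun"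
    show "(\<lambda>n. SUP \<mu>\<in>{\<mu> \<in> space (prob_algebra borel). measure \<mu> (UNIV - K) = 0}.
           ennreal \<bar>(\<integral>y. \<phi> y \<partial>(\<mu> \<bind> iterate \<pi> n)) - (\<integral>y. \<phi> y \<partial>\<nu>)\<bar>) \<longlonglongrightarrow> 0"
    proof (rule tendsto_SUP_ennreal_zeroI)
      fix e :: real assume "0 < e"
      from limE_compact[OF \<phi> \<open>compact K\<close> this]
      show "eventually (\<lambda>n. \<forall>\<mu>\<in>{\<mu> \<in> space (prob_algebra borel). measure \<mu> (UNIV - K) = 0}.
          \<bar>(\<integral>y. \<phi> y \<partial>(\<mu> \<bind> iterate \<pi> n)) - (\<integral>y. \<phi> y \<partial>\<nu>)\<bar> \<le> e) sequentially"
        unfolding integral_invariant[OF \<nu> \<phi>]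
        by eventually_elim (auto intro: concentrated_deviation[OF \<phi> _ \<open>compact K\<close>])
    qed
    show "(\<lambda>n. SUP x\<in>K'. ennreal \<bar>(\<integral>y. \<phi> y \<partial>iterate \<pi> n x) - (\<integral>y. \<phi> y \<partial>\<nu>)\<bar>) \<longlonglongrightarrow> 0"
      if "compact K'" for K'
      unfolding integral_invariant[OF \<nu> \<phi>]
      using limE_compact[OF \<phi> that, unfolded E_def] by (rule tendsto_SUP_ennreal_zeroI)
  qed
qed

end
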